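(* Let $\mathcal{J}\subseteq\{1,\ldots,d\}$ be a set of active variables, with vector of subdivisions $\boldsymbol{S}=(\boldsymbol{S}_i;\, i\in\mathcal{J})$, where $\boldsymbol{S}_i$ has $m_i$ knots $0=t^{(\boldsymbol{S}_i)}_{(1)}<\cdots<t^{(\boldsymbol{S}_i)}_{(m_i)}=1$ and hat basis functions $\phi_{i,1},\ldots,\phi_{i,m_i}$. Let $$\widehat{Y}_{\boldsymbol{S}}(\boldsymbol{x})=\sum_{i\in\mathcal{J}}\sum_{j=1}^{m_i}\widehat{\xi}_{i,j}\,\phi_{i,j}(x_i)$$ be the mode function of the additive constrained Gaussian process model with active set $\mathcal{J}$ and subdivisions $\boldsymbol{S}$. Let $i^\star\in\mathcal{J}$, let $\nu\in\{1,\ldots,m_{i^\star}-1\}$ and let $t$ be such that $t^{(\boldsymbol{S}_{i^\star})}_{(\nu)}<t<t^{(\boldsymbol{S}_{i^\star})}_{(\nu+1)}$. Let $\widetilde{\boldsymbol{S}}_i=\boldsymbol{S}_i$ and $\widetilde{m}_i=m_i$ for $i\in\mathcal{J}\setminus\{i^\star\}$, and $\widetilde{\boldsymbol{S}}_{i^\star}=\boldsymbol{S}_{i^\star}\cup\{t\}$, $\widetilde{m}_{i^\star}=m_{i^\star}+1$. Let $\widetilde{\phi}_{i,1},\ldots,\widetilde{\phi}_{i,\widetilde{m}_i}$ be the hat basis functions of $\widetilde{\boldsymbol{S}}_i$ (so $\widetilde{\phi}_{i,j}=\phi_{i,j}$ for $i\ne i^\star$), and let $$\widehat{Y}_{\boldsymbol{S},i^\star,t}(\boldsymbol{x})=\sum_{i\in\mathcal{J}}\sum_{j=1}^{\widetilde{m}_i}\widetilde{\xi}_{i,j}\,\widetilde{\phi}_{i,j}(x_i)$$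 be the mode function of the model with active set $\mathcal{J}$ and subdivisions $(\widetilde{\boldsymbol{S}}_i;\, i\in\mathcal{J})$. Define $$I_{\boldsymbol{S},i^\star,t}=\int_{[0,1]^{|\mathcal{J}|}}\left(\widehat{Y}_{\boldsymbol{S}}(\boldsymbol{x})-\widehat{Y}_{\boldsymbol{S},i^\star,t}(\boldsymbol{x})\right)^2d\boldsymbol{x}.$$ Then $$I_{\boldsymbol{S},i^\star,t}=\sum_{i\in\mathcal{J}}\ \sum_{\substack{j,j'=1\\ |j-j'|\le1}}^{\widetilde{m}_i}\bar{\eta}_{i,j}\,\bar{\eta}_{i,j'}\,E^{(\widetilde{\boldsymbol{S}}_i)}_{j,j'}-\sum_{i\in\mathcal{J}}\Big(\sum_{j=1}^{\widetilde{m}_i}\bar{\eta}_{i,j}E^{(\widetilde{\boldsymbol{S}}_i)}_{j}\Big)^2+\Big(\sum_{i\in\mathcal{J}}\sum_{j=1}^{\widetilde{m}_i}\bar{\eta}_{i,j}E^{(\widetilde{\boldsymbol{S}}_i)}_{j}\Big)^2,$$ where $\bar{\eta}_{i,j}=\bar{\xi}_{i,j}-\widetilde{\xi}_{i,j}$, with $\bar{\xi}_{i,j}=\widehat{\xi}_{i,j}$ for $i\ne i^\star$, $\bar{\xi}_{i^\star,j}=\widehat{\xi}_{i^\star,j}$ for $j\le\nu$, $\bar{\xi}_{i^\star,j}=\widehat{\xi}_{i^\star,j-1}$ for $j\ge\nu+2$, and $$\bar{\xi}_{i^\star,\nu+1}=\widehat{\xi}_{i^\star,\nu}\,\frac{t^{(\boldsymbol{S}_{i^\star})}_{(\nu+1)}-t}{t^{(\boldsymbol{S}_{i^\star})}_{(\nu+1)}-t^{(\boldsymbol{S}_{i^\star})}_{(\nu)}}+\widehat{\xi}_{i^\star,\nu+1}\,\frac{t-t^{(\boldsymbol{S}_{i^\star})}_{(\nu)}}{t^{(\boldsymbol{S}_{i^\star})}_{(\nu+1)}-t^{(\boldsymbol{S}_{i^\star})}_{(\nu)}},$$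 and where $E^{(\widetilde{\boldsymbol{S}}_i)}_{j}:=\int_0^1\widetilde{\phi}_{i,j}(s)\,ds$ and $E^{(\widetilde{\boldsymbol{S}}_i)}_{j,j'}:=\int_0^1\widetilde{\phi}_{i,j}(s)\widetilde{\phi}_{i,j'}(s)\,ds$ have the following explicit expressions, writing $u_{(1)}<\cdots<u_{(M)}$, $M=\widetilde{m}_i$, for the ordered knots of $\widetilde{\boldsymbol{S}}_i$: $$E^{(\widetilde{\boldsymbol{S}}_i)}_{j}=\begin{cases}\frac{u_{(2)}}{2} & j=1,\\[2pt] \frac{1-u_{(M-1)}}{2} & j=M,\\[2pt] \frac{u_{(j+1)}-u_{(j-1)}}{2} & 2\le j\le M-1,\end{cases} \qquad E^{(\widetilde{\boldsymbol{S}}_i)}_{j,j'}=\begin{cases}\frac{u_{(2)}-u_{(1)}}{3} & j=j'=1,\\[2pt] \frac{u_{(M)}-u_{(M-1)}}{3} & j=j'=M,\\[2pt] \frac{u_{(j+1)}-u_{(j-1)}}{3} & j=j'\in\{2,\ldots,M-1\},\\[2pt] \frac{u_{(j+1)}-u_{(j)}}{6} & j'=j+1,\\[2pt] \frac{u_{(j)}-u_{(j-1)}}{6} & j'=j-1,\\[2pt] 0 & |j-j'|\ge2.\end{cases}$$ The computational cost of evaluating this expression of $I_{\boldsymbol{S},i^\star,t}$ (given the knots and the coefficients $\widehat{\xi}_{i,j}$, $\widetilde{\xi}_{i,j}$) is linear with respect to $m=\sum_{i\in\mathcal{J}}m_i$.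
   Context: Subdivisions and hat functions. A subdivision $\boldsymbol{S}_i$ is a finite subset of $[0,1]$ containing $0$ and $1$; its elements are called knots and are ordered as $0=t^{(\boldsymbol{S}_i)}_{(1)}<\cdots<t^{(\boldsymbol{S}_i)}_{(m_i)}=1$ (so $m_i\ge 2$), with the conventions $t^{(\boldsymbol{S}_i)}_{(0)}=-1$, $t^{(\boldsymbol{S}_i)}_{(m_i+1)}=2$. For $u<v<w$ let $\phi_{u,v,w}(t)=\frac{t-u}{v-u}$ for $u\le t\le v$, $\frac{w-t}{w-v}$ for $v\le t\le w$, and $0$ for $t\notin[u,w]$. The hat basis functions of $\boldsymbol{S}_i$ are $\phi_{i,j}=\phi_{t^{(\boldsymbol{S}_i)}_{(j-1)},t^{(\boldsymbol{S}_i)}_{(j)},t^{(\boldsymbol{S}_i)}_{(j+1)}}$ restricted to $[0,1]$, $j=1,\ldots,m_i$. Mode function. Fix data $\boldsymbol{x}_1,\ldots,\boldsymbol{x}_n\in[0,1]^d$, $\boldsymbol{y}_n\in\mathbb{R}^n$ and a noise variance $\tau^2>0$. For each variable $i$ let $k_i$ be a covariance function on $[0,1]$ (its parameters may be re-estimated for each model). Given an active set $A\subseteq\{1,\ldots,d\}$ and subdivisions $(\boldsymbol{S}_i)_{i\in A}$, let $\boldsymbol{\Sigma}_i=(k_i(t^{(\boldsymbol{S}_i)}_{(a)},t^{(\boldsymbol{S}_i)}_{(b)}))_{a,b}$ be the $m_i\times m_i$ covariance matrix at the knots, and let $\boldsymbol{\Phi}_i$ be the $n\times m_i$ matrix whose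 $(a,b)$ entry is $\phi_{i,b}$ evaluated at the $i$-th coordinate of $\boldsymbol{x}_a$. Let $\boldsymbol{C}=\sum_{p\in A}\boldsymbol{\Phi}_p\boldsymbol{\Sigma}_p\boldsymbol{\Phi}_p^\top+\tau^2\boldsymbol{I}_n$, let $\boldsymbol{\mu}_c$ be the block vector with blocks $\boldsymbol{\mu}_{c,i}=\boldsymbol{\Sigma}_i\boldsymbol{\Phi}_i^\top\boldsymbol{C}^{-1}\boldsymbol{y}_n$, and let $\boldsymbol{\Sigma}_c$ be the block matrix with blocks $\boldsymbol{\Sigma}_{c,i,j}=\mathbf{1}_{i=j}\boldsymbol{\Sigma}_i-\boldsymbol{\Sigma}_i\boldsymbol{\Phi}_i^\top\boldsymbol{C}^{-1}\boldsymbol{\Phi}_j\boldsymbol{\Sigma}_j$ ($i,j\in A$), assumed invertible. Each variable $i$ carries linear inequality constraints on the values at its knots, $\boldsymbol{l}_i\le\boldsymbol{\Lambda}_i\boldsymbol{c}_i\le\boldsymbol{u}_i$, $\boldsymbol{c}_i\in\mathbb{R}^{m_i}$, with $\boldsymbol{\Lambda}_i,\boldsymbol{l}_i,\boldsymbol{u}_i$ depending on the subdivision $\boldsymbol{S}_i$ (for example $c_{i,j}-c_{i,j-1}\ge0$ for all $j\ge 2$, encoding monotonicity); the constraints are feasible. The coefficients of the mode are $$\widehat{\boldsymbol{\xi}}=\underset{\boldsymbol{c}=(\boldsymbol{c}_i)_{i\in A}:\ \boldsymbol{l}_i\le\boldsymbol{\Lambda}_i\boldsymbol{c}_i\le\boldsymbol{u}_i,\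 i\in A}{\mathrm{argmin}}(\boldsymbol{c}-\boldsymbol{\mu}_c)^\top\boldsymbol{\Sigma}_c^{-1}(\boldsymbol{c}-\boldsymbol{\mu}_c),$$ and the mode function of the model is $\boldsymbol{x}\mapsto\sum_{i\in A}\sum_{j=1}^{m_i}\widehat{\xi}_{i,j}\phi_{i,j}(x_i)$ on $[0,1]^{|A|}$. In the claim, $\widehat{\xi}$ denotes the coefficients obtained for active set $\mathcal{J}$ and subdivisions $(\boldsymbol{S}_i)_{i\in\mathcal{J}}$, and $\widetilde{\xi}$ those obtained by the same construction for active set $\mathcal{J}$ and subdivisions $(\widetilde{\boldsymbol{S}}_i)_{i\in\mathcal{J}}$ (all knot counts, basis functions, matrices and constraints being those of the refined subdivisions). *)

theory Defs
  imports "HOL-Analysis.Analysis" "Jordan_Normal_Form.Gauss_Jordan_Elimination"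
begin

section \<open>Subdivisions and hat functions\<close>

definition subdivision :: "real set \<Rightarrow> bool" where
  "subdivision T \<longleftrightarrow> finite T \<and> 0 \<in> T \<and> 1 \<in> T \<and> T \<subseteq> {0..1}"

text \<open>Knots are numbered from 1 to \<open>card T\<close>, with the two fictitious outer knots -1 and 2.\<close>

definition knot :: "real set \<Rightarrow> nat \<Rightarrow> real" where
  "knot T j = (if j = 0 then -1
               else if j \<le> card T then sorted_list_of_set T ! (j - 1)
               else 2)"

definition hat :: "real \<Rightarrow> real \<Rightarrow> real \<Rightarrow> real \<Rightarrow> real" where
  "hat u v w s = (if u \<le> s \<and> s \<le> v then (s - u) / (v - u)
                  else if v \<le> s \<and> s \<le> w then (w - s) / (w - v)
                  else 0)"

definition hat_basis :: "real set \<Rightarrow> nat \<Rightarrow> real \<Rightarrow> real" where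
  "hat_basis T j = hat (knot T (j - 1)) (knot T j) (knot T (j + 1))"

definition hat_integral :: "real set \<Rightarrow> nat \<Rightarrow> real" where
  "hat_integral T j = (LINT s:{0..1}|lborel. hat_basis T j s)"

definition hat_integral2 :: "real set \<Rightarrow> nat \<Rightarrow> nat \<Rightarrow> real" where
  "hat_integral2 T j j' = (LINT s:{0..1}|lborel. hat_basis T j s * hat_basis T j' s)"


section \<open>The mode of an additive constrained Gaussian process model\<close>

definition covariance_function_on :: "real set \<Rightarrow> (real \<Rightarrow> real \<Rightarrow> real) \<Rightarrow> bool" where
  "covariance_function_on D k \<longleftrightarrow>
     (\<forall>s\<in>D. \<forall>t\<in>D. k s t = k t s) \<and>
     (\<forall>F w. finite F \<and> F \<subseteq> D \<longrightarrow> (\<Sum>s\<in>F. \<Sum>t\<in>F. w s * w t * k s t) \<ge> 0)"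

text \<open>
  Library vectors and matrices are indexed from 0, whereas observations, variables, knots and
  basis functions are numbered from 1. The point \<open>X a\<close> (\<open>1 \<le> a \<le> n\<close>) has the coordinates
  \<open>X a i\<close> (\<open>1 \<le> i \<le> d\<close>), and the number \<open>n\<close> of observations is \<open>dim_vec y\<close>.
\<close>

definition knot_cov :: "(nat \<Rightarrow> real \<Rightarrow> real \<Rightarrow> real) \<Rightarrow> (nat \<Rightarrow> real set) \<Rightarrow> nat \<Rightarrow> real mat" where
  "knot_cov k S i = Matrix.mat (card (S i)) (card (S i))
     (\<lambda>(a, b). k i (knot (S i) (a + 1)) (knot (S i) (b + 1)))"

definition design :: "nat \<Rightarrow> (nat \<Rightarrow> nat \<Rightarrow> real) \<Rightarrow> (nat \<Rightarrow> real set) \<Rightarrow> nat \<Rightarrow> real mat" where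
  "design n X S i = Matrix.mat n (card (S i)) (\<lambda>(a, b). hat_basis (S i) (b + 1) (X (a + 1) i))"

definition obs_cov ::
  "nat \<Rightarrow> (nat \<Rightarrow> nat \<Rightarrow> real) \<Rightarrow> real \<Rightarrow> (nat \<Rightarrow> real \<Rightarrow> real \<Rightarrow> real) \<Rightarrow>
   nat set \<Rightarrow> (nat \<Rightarrow> real set) \<Rightarrow> real mat" where
  "obs_cov n X tau2 k A S =
     Matrix.mat n n (\<lambda>(a, b). \<Sum>p\<in>A.
       (design n X S p * knot_cov k S p * transpose_mat (design n X S p)) $$ (a, b))
     + tau2 \<cdot>\<^sub>m 1\<^sub>m n"

definition inv_mat :: "real mat \<Rightarrow> real mat" where
  "inv_mat M = the (mat_inverse M)"

definition cond_mean_block ::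
  "(nat \<Rightarrow> nat \<Rightarrow> real) \<Rightarrow> real Matrix.vec \<Rightarrow> real \<Rightarrow> (nat \<Rightarrow> real \<Rightarrow> real \<Rightarrow> real) \<Rightarrow>
   nat set \<Rightarrow> (nat \<Rightarrow> real set) \<Rightarrow> nat \<Rightarrow> real Matrix.vec" where
  "cond_mean_block X y tau2 k A S i =
     (let n = dim_vec y in
      (knot_cov k S i * transpose_mat (design n X S i) * inv_mat (obs_cov n X tau2 k A S)) *\<^sub>v y)"

definition cond_cov_block ::
  "nat \<Rightarrow> (nat \<Rightarrow> nat \<Rightarrow> real) \<Rightarrow> real \<Rightarrow> (nat \<Rightarrow> real \<Rightarrow> real \<Rightarrow> real) \<Rightarrow>
   nat set \<Rightarrow> (nat \<Rightarrow> real set) \<Rightarrow> nat \<Rightarrow> nat \<Rightarrow> real mat" where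
  "cond_cov_block n X tau2 k A S i j =
     (if i = j then knot_cov k S i else 0\<^sub>m (card (S i)) (card (S j)))
     - knot_cov k S i * transpose_mat (design n X S i) * inv_mat (obs_cov n X tau2 k A S)
       * design n X S j * knot_cov k S j"

text \<open>
  The rows of block vectors and matrices are enumerated by the pairs (variable, 0-based position
  in the block) in lexicographic order.
\<close>

definition block_index :: "nat set \<Rightarrow> (nat \<Rightarrow> real set) \<Rightarrow> (nat \<times> nat) list" where
  "block_index A S = concat (map (\<lambda>i. map (Pair i) [0..<card (S i)]) (sorted_list_of_set A))"

definition block_vec ::
  "nat set \<Rightarrow> (nat \<Rightarrow> real set) \<Rightarrow> (nat \<Rightarrow> real Matrix.vec) \<Rightarrow> real Matrix.vec" where
  "block_vec A S v = (let ix = block_index A S in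
     Matrix.vec (length ix) (\<lambda>r. v (fst (ix ! r)) $ snd (ix ! r)))"

definition block_mat ::
  "nat set \<Rightarrow> (nat \<Rightarrow> real set) \<Rightarrow> (nat \<Rightarrow> nat \<Rightarrow> real mat) \<Rightarrow> real mat" where
  "block_mat A S B = (let ix = block_index A S in
     Matrix.mat (length ix) (length ix)
       (\<lambda>(r, c). B (fst (ix ! r)) (fst (ix ! c)) $$ (snd (ix ! r), snd (ix ! c))))"

definition cond_mean ::
  "(nat \<Rightarrow> nat \<Rightarrow> real) \<Rightarrow> real Matrix.vec \<Rightarrow> real \<Rightarrow> (nat \<Rightarrow> real \<Rightarrow> real \<Rightarrow> real) \<Rightarrow>
   nat set \<Rightarrow> (nat \<Rightarrow> real set) \<Rightarrow> real Matrix.vec" where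
  "cond_mean X y tau2 k A S = block_vec A S (cond_mean_block X y tau2 k A S)"

definition cond_cov ::
  "nat \<Rightarrow> (nat \<Rightarrow> nat \<Rightarrow> real) \<Rightarrow> real \<Rightarrow> (nat \<Rightarrow> real \<Rightarrow> real \<Rightarrow> real) \<Rightarrow>
   nat set \<Rightarrow> (nat \<Rightarrow> real set) \<Rightarrow> real mat" where
  "cond_cov n X tau2 k A S = block_mat A S (cond_cov_block n X tau2 k A S)"

text \<open>
  \<open>Lam i T\<close>, \<open>lo i T\<close>, \<open>up i T\<close> are the constraint matrix and bounds of variable \<open>i\<close> for the
  subdivision \<open>T\<close>. Bounds are extended reals since one-sided constraints such as monotonicity
  have infinite bounds.
\<close>

definition constraint_dims ::
  "real mat \<Rightarrow> ereal Matrix.vec \<Rightarrow> ereal Matrix.vec \<Rightarrow> nat \<Rightarrow> bool" where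
  "constraint_dims L l u m \<longleftrightarrow>
     dim_col L = m \<and> dim_vec l = dim_row L \<and> dim_vec u = dim_row L"

definition feasible ::
  "(nat \<Rightarrow> real set \<Rightarrow> real mat) \<Rightarrow> (nat \<Rightarrow> real set \<Rightarrow> ereal Matrix.vec) \<Rightarrow>
   (nat \<Rightarrow> real set \<Rightarrow> ereal Matrix.vec) \<Rightarrow> nat set \<Rightarrow> (nat \<Rightarrow> real set) \<Rightarrow>
   (nat \<Rightarrow> real Matrix.vec) \<Rightarrow> bool" where
  "feasible Lam lo up A S c \<longleftrightarrow>
     c \<in> (\<Pi>\<^sub>E i\<in>A. carrier_vec (card (S i))) \<and>
     (\<forall>i\<in>A. \<forall>r < dim_row (Lam i (S i)).
        lo i (S i) $ r \<le> ereal ((Lam i (S i) *\<^sub>v c i) $ r) \<and>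
        ereal ((Lam i (S i) *\<^sub>v c i) $ r) \<le> up i (S i) $ r)"

definition mode_objective ::
  "(nat \<Rightarrow> nat \<Rightarrow> real) \<Rightarrow> real Matrix.vec \<Rightarrow> real \<Rightarrow> (nat \<Rightarrow> real \<Rightarrow> real \<Rightarrow> real) \<Rightarrow>
   nat set \<Rightarrow> (nat \<Rightarrow> real set) \<Rightarrow> (nat \<Rightarrow> real Matrix.vec) \<Rightarrow> real" where
  "mode_objective X y tau2 k A S c =
     (let w = block_vec A S c - cond_mean X y tau2 k A S in
      scalar_prod w (inv_mat (cond_cov (dim_vec y) X tau2 k A S) *\<^sub>v w))"

definition mode_coeffs ::
  "(nat \<Rightarrow> nat \<Rightarrow> real) \<Rightarrow> real Matrix.vec \<Rightarrow> real \<Rightarrow> (nat \<Rightarrow> real \<Rightarrow> real \<Rightarrow> real) \<Rightarrow>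
   (nat \<Rightarrow> real set \<Rightarrow> real mat) \<Rightarrow> (nat \<Rightarrow> real set \<Rightarrow> ereal Matrix.vec) \<Rightarrow>
   (nat \<Rightarrow> real set \<Rightarrow> ereal Matrix.vec) \<Rightarrow> nat set \<Rightarrow> (nat \<Rightarrow> real set) \<Rightarrow>
   nat \<Rightarrow> nat \<Rightarrow> real" where
  "mode_coeffs X y tau2 k Lam lo up A S i j =
     arg_min (mode_objective X y tau2 k A S) (feasible Lam lo up A S) i $ (j - 1)"

definition mode_fun ::
  "nat set \<Rightarrow> (nat \<Rightarrow> real set) \<Rightarrow> (nat \<Rightarrow> nat \<Rightarrow> real) \<Rightarrow> (nat \<Rightarrow> real) \<Rightarrow> real" where
  "mode_fun A S xi x = (\<Sum>i\<in>A. \<Sum>j = 1..card (S i). xi i j * hat_basis (S i) j (x i))"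

text \<open>The standing assumptions on a model with active set \<open>A\<close> and subdivisions \<open>S\<close>.\<close>

definition model_assumptions ::
  "nat \<Rightarrow> (nat \<Rightarrow> nat \<Rightarrow> real) \<Rightarrow> real \<Rightarrow> (nat \<Rightarrow> real \<Rightarrow> real \<Rightarrow> real) \<Rightarrow>
   (nat \<Rightarrow> real set \<Rightarrow> real mat) \<Rightarrow> (nat \<Rightarrow> real set \<Rightarrow> ereal Matrix.vec) \<Rightarrow>
   (nat \<Rightarrow> real set \<Rightarrow> ereal Matrix.vec) \<Rightarrow> nat set \<Rightarrow> (nat \<Rightarrow> real set) \<Rightarrow> bool" where
  "model_assumptions n X tau2 k Lam lo up A S \<longleftrightarrow>
     (\<forall>i\<in>A. subdivision (S i)) \<and>
     (\<forall>i\<in>A. covariance_function_on {0..1} (k i)) \<and>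
     (\<forall>i\<in>A. constraint_dims (Lam i (S i)) (lo i (S i)) (up i (S i)) (card (S i))) \<and>
     invertible_mat (cond_cov n X tau2 k A S) \<and>
     (\<exists>c. feasible Lam lo up A S c)"


section \<open>Explicit expressions of the integrals of hat functions\<close>

definition hat_integral_explicit :: "real set \<Rightarrow> nat \<Rightarrow> real" where
  "hat_integral_explicit T j =
     (let M = card T; u = knot T in
      if j = 1 then u 2 / 2
      else if j = M then (1 - u (M - 1)) / 2
      else (u (j + 1) - u (j - 1)) / 2)"

definition hat_integral2_explicit :: "real set \<Rightarrow> nat \<Rightarrow> nat \<Rightarrow> real" where
  "hat_integral2_explicit T j j' =
     (let M = card T; u = knot T in
      if j = j' then
        (if j = 1 then (u 2 - u 1) / 3
         else if j = M then (u M - u (M - 1)) / 3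
         else (u (j + 1) - u (j - 1)) / 3)
      else if j' = j + 1 then (u (j + 1) - u j) / 6
      else if j = j' + 1 then (u j - u (j - 1)) / 6
      else 0)"


section \<open>Cost of evaluating an expression\<close>

text \<open>
  Expressions over the real numbers with bounded summation, over an input consisting of the active
  set, the number of knots of each variable, \<open>i\<^sup>\<star>\<close>, \<open>\<nu>\<close>, the new knot and arrays of reals. Summation
  ranges over the active set or over a range of natural numbers (both bounds included).
\<close>

datatype loop_var = Var_i | Var_j | Var_j2

datatype index_expr =
  Num nat
| Loop loop_var
| Star
| Pos
| Size index_expr
| Succ index_expr
| Pred index_expr

datatype test =
  Eq index_expr index_expr
| Le index_expr index_expr

datatype input_array = Old_knot | New_knot | Coef_hat | Coef_tilde

datatype real_expr =
  Const int
| New_point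
| Read input_array index_expr index_expr
| Plus real_expr real_expr
| Minus real_expr real_expr
| Times real_expr real_expr
| Divide real_expr real_expr
| Square real_expr
| Cond test real_expr real_expr
| Sum_active loop_var real_expr
| Sum_range loop_var index_expr index_expr real_expr

record eval_input =
  in_active :: "nat set"
  in_size :: "nat \<Rightarrow> nat"
  in_star :: nat
  in_pos :: nat
  in_point :: real
  in_array :: "input_array \<Rightarrow> nat \<Rightarrow> nat \<Rightarrow> real"

primrec index_val :: "eval_input \<Rightarrow> index_expr \<Rightarrow> (loop_var \<Rightarrow> nat) \<Rightarrow> nat" where
  "index_val inp (Num m) env = m"
| "index_val inp (Loop v) env = env v"
| "index_val inp Star env = in_star inp"
| "index_val inp Pos env = in_pos inp"
| "index_val inp (Size a) env = in_size inp (index_val inp a env)"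
| "index_val inp (Succ a) env = index_val inp a env + 1"
| "index_val inp (Pred a) env = index_val inp a env - 1"

primrec test_val :: "eval_input \<Rightarrow> test \<Rightarrow> (loop_var \<Rightarrow> nat) \<Rightarrow> bool" where
  "test_val inp (Eq a b) env \<longleftrightarrow> index_val inp a env = index_val inp b env"
| "test_val inp (Le a b) env \<longleftrightarrow> index_val inp a env \<le> index_val inp b env"

primrec expr_val :: "eval_input \<Rightarrow> real_expr \<Rightarrow> (loop_var \<Rightarrow> nat) \<Rightarrow> real" where
  "expr_val inp (Const z) env = of_int z"
| "expr_val inp New_point env = in_point inp"
| "expr_val inp (Read r a b) env = in_array inp r (index_val inp a env) (index_val inp b env)"
| "expr_val inp (Plus e f) env = expr_val inp e env + expr_val inp f env"
| "expr_val inp (Minus e f) env = expr_val inp e env - expr_val inp f env"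
| "expr_val inp (Times e f) env = expr_val inp e env * expr_val inp f env"
| "expr_val inp (Divide e f) env = expr_val inp e env / expr_val inp f env"
| "expr_val inp (Square e) env = (expr_val inp e env)\<^sup>2"
| "expr_val inp (Cond t e f) env =
     (if test_val inp t env then expr_val inp e env else expr_val inp f env)"
| "expr_val inp (Sum_active v e) env =
     (\<Sum>i\<in>in_active inp. expr_val inp e (env(v := i)))"
| "expr_val inp (Sum_range v a b e) env =
     (\<Sum>j = index_val inp a env..index_val inp b env. expr_val inp e (env(v := j)))"

text \<open>
  Unit cost for every constant, input access, arithmetic operation on reals or indices, comparison,
  and for the start and each iteration of a summation loop. Nothing is shared between subexpressions.
\<close>

primrec index_cost :: "index_expr \<Rightarrow> nat" where
  "index_cost (Num m) = 1"
| "index_cost (Loop v) = 1"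
| "index_cost Star = 1"
| "index_cost Pos = 1"
| "index_cost (Size a) = 1 + index_cost a"
| "index_cost (Succ a) = 1 + index_cost a"
| "index_cost (Pred a) = 1 + index_cost a"

primrec test_cost :: "test \<Rightarrow> nat" where
  "test_cost (Eq a b) = 1 + index_cost a + index_cost b"
| "test_cost (Le a b) = 1 + index_cost a + index_cost b"

primrec expr_cost :: "eval_input \<Rightarrow> real_expr \<Rightarrow> (loop_var \<Rightarrow> nat) \<Rightarrow> nat" where
  "expr_cost inp (Const z) env = 1"
| "expr_cost inp New_point env = 1"
| "expr_cost inp (Read r a b) env = 1 + index_cost a + index_cost b"
| "expr_cost inp (Plus e f) env = 1 + expr_cost inp e env + expr_cost inp f env"
| "expr_cost inp (Minus e f) env = 1 + expr_cost inp e env + expr_cost inp f env"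
| "expr_cost inp (Times e f) env = 1 + expr_cost inp e env + expr_cost inp f env"
| "expr_cost inp (Divide e f) env = 1 + expr_cost inp e env + expr_cost inp f env"
| "expr_cost inp (Square e) env = 1 + expr_cost inp e env"
| "expr_cost inp (Cond t e f) env = 1 + test_cost t +
     (if test_val inp t env then expr_cost inp e env else expr_cost inp f env)"
| "expr_cost inp (Sum_active v e) env =
     1 + (\<Sum>i\<in>in_active inp. 1 + expr_cost inp e (env(v := i)))"
| "expr_cost inp (Sum_range v a b e) env =
     1 + index_cost a + index_cost b +
     (\<Sum>j = index_val inp a env..index_val inp b env. 1 + expr_cost inp e (env(v := j)))"


section \<open>The expression of the squared distance between the two modes\<close>

definition xi_bar_expr :: "index_expr \<Rightarrow> index_expr \<Rightarrow> real_expr" where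
  "xi_bar_expr i j =
     (let a = Read Old_knot i Pos; b = Read Old_knot i (Succ Pos) in
      Cond (Eq i Star)
        (Cond (Le j Pos) (Read Coef_hat i j)
          (Cond (Eq j (Succ Pos))
            (Plus
              (Times (Read Coef_hat i Pos) (Divide (Minus b New_point) (Minus b a)))
              (Times (Read Coef_hat i (Succ Pos)) (Divide (Minus New_point a) (Minus b a))))
            (Read Coef_hat i (Pred j))))
        (Read Coef_hat i j))"

definition eta_bar_expr :: "index_expr \<Rightarrow> index_expr \<Rightarrow> real_expr" where
  "eta_bar_expr i j = Minus (xi_bar_expr i j) (Read Coef_tilde i j)"

definition hat_integral_expr :: "index_expr \<Rightarrow> index_expr \<Rightarrow> real_expr" where
  "hat_integral_expr i j =
     Cond (Eq j (Num 1)) (Divide (Read New_knot i (Num 2)) (Const 2))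
       (Cond (Eq j (Size i))
         (Divide (Minus (Const 1) (Read New_knot i (Pred (Size i)))) (Const 2))
         (Divide (Minus (Read New_knot i (Succ j)) (Read New_knot i (Pred j))) (Const 2)))"

definition hat_integral2_expr :: "index_expr \<Rightarrow> index_expr \<Rightarrow> index_expr \<Rightarrow> real_expr" where
  "hat_integral2_expr i j j' =
     Cond (Eq j j')
       (Cond (Eq j (Num 1))
         (Divide (Minus (Read New_knot i (Num 2)) (Read New_knot i (Num 1))) (Const 3))
         (Cond (Eq j (Size i))
           (Divide (Minus (Read New_knot i (Size i)) (Read New_knot i (Pred (Size i)))) (Const 3))
           (Divide (Minus (Read New_knot i (Succ j)) (Read New_knot i (Pred j))) (Const 3))))
       (Cond (Eq j' (Succ j))
         (Divide (Minus (Read New_knot i (Succ j)) (Read New_knot i j)) (Const 6))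
         (Cond (Eq j (Succ j'))
           (Divide (Minus (Read New_knot i j) (Read New_knot i (Pred j))) (Const 6))
           (Const 0)))"

text \<open>In the double sum, \<open>j'\<close> runs over \<open>j - 1, j, j + 1\<close>, and values outside \<open>1..M\<close> are skipped.\<close>

definition mode_distance_expr :: real_expr where
  "mode_distance_expr =
     (let i = Loop Var_i; j = Loop Var_j; j' = Loop Var_j2;
          linear_part = Sum_range Var_j (Num 1) (Size i) (Times (eta_bar_expr i j) (hat_integral_expr i j))
      in
      Plus
        (Minus
          (Sum_active Var_i (Sum_range Var_j (Num 1) (Size i) (Sum_range Var_j2 (Pred j) (Succ j)
            (Cond (Le (Num 1) j')
              (Cond (Le j' (Size i))
                (Times (Times (eta_bar_expr i j) (eta_bar_expr i j')) (hat_integral2_expr i j j'))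
                (Const 0))
              (Const 0)))))
          (Sum_active Var_i (Square linear_part)))
        (Square (Sum_active Var_i linear_part)))"

definition mode_distance_input ::
  "nat set \<Rightarrow> (nat \<Rightarrow> real set) \<Rightarrow> nat \<Rightarrow> nat \<Rightarrow> real \<Rightarrow> (nat \<Rightarrow> nat \<Rightarrow> real) \<Rightarrow>
   (nat \<Rightarrow> nat \<Rightarrow> real) \<Rightarrow> eval_input" where
  "mode_distance_input A S istar nu t xi_hat xi_tilde =
     (let St = S(istar := insert t (S istar)) in
      \<lparr> in_active = A, in_size = (\<lambda>i. card (St i)), in_star = istar, in_pos = nu, in_point = t,
        in_array = (\<lambda>r. case r of
            Old_knot \<Rightarrow> \<lambda>i. knot (S i)
          | New_knot \<Rightarrow> \<lambda>i. knot (St i)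
          | Coef_hat \<Rightarrow> xi_hat
          | Coef_tilde \<Rightarrow> xi_tilde) \<rparr>)"

end

theory Submission
  imports Defs
begin

text \<open>
  The coarse mode is piecewise linear, so interpolating its coefficients at the new knot writes it
  in the refined basis. The difference of the two modes is then an additive function
  \<open>x \<mapsto> \<Sum>\<^sub>i g\<^sub>i (x\<^sub>i)\<close>, and under the uniform distribution on the cube the
  coordinates are independent, so the cross terms of its square integrate to products of means:
  the integral is \<open>\<Sum>\<^sub>i \<integral> g\<^sub>i\<^sup>2 - \<Sum>\<^sub>i (\<integral> g\<^sub>i)\<^sup>2 + (\<Sum>\<^sub>i \<integral> g\<^sub>i)\<^sup>2\<close>.
  Hat functions at distance at least 2 have supports with at most one
  common point, where both vanish, so the double sums have at most three
  terms per knot, hence the linear cost.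
\<close>

section \<open>Knots and hat functions\<close>

lemma card_subdivision_ge_2:
  assumes "subdivision T"
  shows "2 \<le> card T"
proof -
  have "card {0, 1::real} \<le> card T"
    using assms unfolding subdivision_def by (intro card_mono) auto
  then show ?thesis by simp
qed

lemma knot_image:
  assumes "finite T"
  shows "knot T ` {1..card T} = T"
proof
  show "knot T ` {1..card T} \<subseteq> T"
  proof
    fix x assume "x \<in> knot T ` {1..card T}"
    then obtain j where j: "1 \<le> j" "j \<le> card T" "x = sorted_list_of_set T ! (j - 1)"
      by (auto simp: knot_def)
    then have "x \<in> set (sorted_list_of_set T)"
      by (metis One_nat_def Suc_le_lessD Suc_pred assms length_sorted_list_of_set less_le_trans
          nat_less_le not_less nth_mem zero_less_one)
    then show "x \<in> T" using assms by simp
  qed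
  show "T \<subseteq> knot T ` {1..card T}"
  proof
    fix x assume "x \<in> T"
    then obtain i where "i < card T" "sorted_list_of_set T ! i = x"
      using assms by (metis in_set_conv_nth length_sorted_list_of_set set_sorted_list_of_set)
    then show "x \<in> knot T ` {1..card T}"
      by (intro image_eqI[of _ _ "Suc i"]) (auto simp: knot_def)
  qed
qed

lemma knot_in_unit_interval:
  assumes "subdivision T" "j \<in> {1..card T}"
  shows "0 \<le> knot T j" "knot T j \<le> 1"
proof -
  have "knot T j \<in> T" using knot_image[of T] assms by (auto simp: subdivision_def)
  then show "0 \<le> knot T j" "knot T j \<le> 1" using assms by (auto simp: subdivision_def)
qed

text \<open>Monotonicity extends to the two fictitious knots because -1 and 2 lie strictly outside
  the unit interval; hence the first and the last hat are nondegenerate too.\<close>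

lemma knot_less:
  assumes "subdivision T" "i < j" "j \<le> card T + 1"
  shows "knot T i < knot T j"
proof (cases "i = 0 \<or> j = card T + 1")
  case True
  have [simp]: "knot T 0 = -1" "knot T (Suc (card T)) = 2" by (auto simp: knot_def)
  show ?thesis
    using True assms knot_in_unit_interval[OF assms(1), of i] knot_in_unit_interval[OF assms(1), of j]
    by (cases "i = 0"; cases "j = card T + 1") auto
next
  case False
  have "sorted_wrt (<) (sorted_list_of_set T)" by simp
  then have "sorted_list_of_set T ! (i - 1) < sorted_list_of_set T ! (j - 1)"
    by (rule sorted_wrt_nth_less) (use False assms in auto)
  then show ?thesis using False assms by (auto simp: knot_def)
qed

lemma knot_le:
  assumes "subdivision T" "i \<le> j" "j \<le> card T + 1"
  shows "knot T i \<le> knot T j"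
  using knot_less[OF assms(1), of i j] assms by (cases "i = j") auto

lemma knot_first:
  assumes "subdivision T"
  shows "knot T 1 = 0"
proof -
  obtain j where j: "j \<in> {1..card T}" "knot T j = 0"
    using knot_image[of T] assms by (metis imageE subdivision_def)
  have "knot T 1 \<le> knot T j" using j by (intro knot_le assms) auto
  then show ?thesis using j knot_in_unit_interval[OF assms, of 1] by auto
qed

lemma knot_last:
  assumes "subdivision T"
  shows "knot T (card T) = 1"
proof -
  obtain j where j: "j \<in> {1..card T}" "knot T j = 1"
    using knot_image[of T] assms by (metis imageE subdivision_def)
  have "knot T j \<le> knot T (card T)" using j by (intro knot_le assms) auto
  then show ?thesis using j knot_in_unit_interval[OF assms, of "card T"] by auto
qed

text \<open>A finite set of reals has only one strictly increasing enumeration, so the knots of a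
  refined subdivision can be guessed and then verified.\<close>

lemma knot_eqI:
  assumes "finite T" and mono: "\<And>i j. 1 \<le> i \<Longrightarrow> i < j \<Longrightarrow> j \<le> card T \<Longrightarrow> f i < f j"
    and image: "f ` {1..card T} = T" and j: "1 \<le> j" "j \<le> card T"
  shows "knot T j = f j"
proof -
  let ?xs = "map f [1..<card T + 1]"
  have "sorted_wrt (<) ?xs"
    unfolding sorted_wrt_iff_nth_less by (auto intro!: mono simp del: upt_Suc)
  moreover have "set ?xs = T" using image by (simp add: atLeastLessThanSuc_atLeastAtMost del: upt_Suc)
  ultimately have "sorted_list_of_set T = ?xs"
    using assms(1) by (intro strict_sorted_equal) auto
  then show ?thesis using j by (simp add: knot_def del: upt_Suc)
qed

lemma obtain_knot_interval:
  assumes "subdivision T" "s \<in> {0..1}"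
  obtains j where "1 \<le> j" "j + 1 \<le> card T" "knot T j \<le> s" "s \<le> knot T (j + 1)"
proof -
  \<comment> \<open>The index is capped at \<open>card T - 1\<close> so that \<open>s = 1\<close>
    falls into the last interval; below the cap, maximality bounds \<open>s\<close> from
    above.\<close>
  let ?j = "Max {j \<in> {1..card T - 1}. knot T j \<le> s}"
  have fin: "finite {j \<in> {1..card T - 1}. knot T j \<le> s}" by simp
  have "1 \<in> {j \<in> {1..card T - 1}. knot T j \<le> s}"
    using assms knot_first card_subdivision_ge_2[OF assms(1)] by auto
  then have mem: "?j \<in> {j \<in> {1..card T - 1}. knot T j \<le> s}" using fin Max_in by blast
  have "s \<le> knot T (?j + 1)"
  proof (cases "?j + 1 = card T")
    case True
    then show ?thesis using assms knot_last[OF assms(1)] by simp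
  next
    case False
    show ?thesis
    proof (rule ccontr)
      assume "\<not> s \<le> knot T (?j + 1)"
      then have "?j + 1 \<in> {j \<in> {1..card T - 1}. knot T j \<le> s}" using False mem by auto
      then have "?j + 1 \<le> ?j" using fin by (intro Max_ge)
      then show False by simp
    qed
  qed
  moreover have "?j + 1 \<le> card T" using mem card_subdivision_ge_2[OF assms(1)] by auto
  ultimately show thesis using mem that by auto
qed

section \<open>Hat functions: bounds, branches and support\<close>

lemma hat_measurable [measurable]: "hat u v w \<in> borel_measurable borel"
  unfolding hat_def[abs_def] by measurable

lemma hat_nonneg:
  assumes "u < v" "v < w"
  shows "0 \<le> hat u v w s"
  using assms by (auto simp: hat_def)

lemma hat_le_1:
  assumes "u < v" "v < w"
  shows "hat u v w s \<le> 1"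
  using assms by (auto simp: hat_def)

lemma hat_basis_measurable [measurable]: "hat_basis T j \<in> borel_measurable borel"
  unfolding hat_basis_def by measurable

lemma hat_basis_bounds:
  assumes "subdivision T" "j \<in> {1..card T}"
  shows "0 \<le> hat_basis T j s" "hat_basis T j s \<le> 1"
  using assms by (auto simp: hat_basis_def intro!: hat_nonneg hat_le_1 knot_less)

lemma hat_basis_ascending:
  assumes "subdivision T" "j \<in> {1..card T}" "knot T (j - 1) \<le> s" "s \<le> knot T j"
  shows "hat_basis T j s = (s - knot T (j - 1)) / (knot T j - knot T (j - 1))"
  using assms by (auto simp: hat_basis_def hat_def)

lemma hat_basis_descending:
  assumes "subdivision T" "j \<in> {1..card T}" "knot T j \<le> s" "s \<le> knot T (j + 1)"
  shows "hat_basis T j s = (knot T (j + 1) - s) / (knot T (j + 1) - knot T j)"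
  \<comment> \<open>At \<open>s = knot T j\<close> the definition of \<open>hat\<close> takes its
    ascending branch. Both ramps are 1 there, since neighbouring knots are distinct.\<close>
  using assms knot_less[OF assms(1), of "j - 1" j] knot_less[OF assms(1), of j "j + 1"]
  by (auto simp: hat_basis_def hat_def)

lemma hat_basis_eq_0:
  assumes "subdivision T" "j \<in> {1..card T}" "s \<le> knot T (j - 1) \<or> knot T (j + 1) \<le> s"
  shows "hat_basis T j s = 0"
  using assms knot_less[OF assms(1), of "j - 1" j] knot_less[OF assms(1), of j "j + 1"]
  by (auto simp: hat_basis_def hat_def)

text \<open>Only the hats centred at the two ends of the interval survive, and they are its
  descending and ascending ramps: the sum is linear interpolation of the coefficients.\<close>

lemma sum_hat_basis_interval:
  assumes T: "subdivision T" and j: "1 \<le> j" "j + 1 \<le> card T"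
    and s: "knot T j \<le> s" "s \<le> knot T (j + 1)"
  shows "(\<Sum>l = 1..card T. xi l * hat_basis T l s)
    = (xi j * (knot T (j + 1) - s) + xi (j + 1) * (s - knot T j)) / (knot T (j + 1) - knot T j)"
proof -
  have "(\<Sum>l = 1..card T. xi l * hat_basis T l s) = (\<Sum>l \<in> {j, j + 1}. xi l * hat_basis T l s)"
  proof (rule sum.mono_neutral_right)
    show "\<forall>l\<in>{1..card T} - {j, j + 1}. xi l * hat_basis T l s = 0"
    proof
      fix l assume l: "l \<in> {1..card T} - {j, j + 1}"
      then consider "l + 1 \<le> j" | "j + 1 \<le> l - 1" by fastforce
      then have "s \<le> knot T (l - 1) \<or> knot T (l + 1) \<le> s"
      proof cases
        case 1
        then have "knot T (l + 1) \<le> knot T j" using j by (intro knot_le T) auto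
        then show ?thesis using s by simp
      next
        case 2
        then have "knot T (j + 1) \<le> knot T (l - 1)" using l by (intro knot_le T) auto
        then show ?thesis using s by simp
      qed
      then show "xi l * hat_basis T l s = 0" using hat_basis_eq_0[OF T, of l s] l by simp
    qed
  qed (use j in auto)
  also have "\<dots> = xi j * hat_basis T j s + xi (j + 1) * hat_basis T (j + 1) s" by simp
  also have "hat_basis T j s = (knot T (j + 1) - s) / (knot T (j + 1) - knot T j)"
    using j s by (intro hat_basis_descending T) auto
  also have "hat_basis T (j + 1) s = (s - knot T j) / (knot T (j + 1) - knot T j)"
    using hat_basis_ascending[OF T, of "j + 1" s] j s by auto
  finally show ?thesis by (simp add: add_divide_distrib)
qed

section \<open>Inserting a knot\<close>

lemma subdivision_insert:
  assumes "subdivision T" "q \<in> {1..card T - 1}" "knot T q < t" "t < knot T (q + 1)"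
  shows "subdivision (insert t T)" "card (insert t T) = card T + 1"
proof -
  have "0 \<le> t" "t \<le> 1"
    using assms knot_in_unit_interval[of T q] knot_in_unit_interval[of T "q + 1"] by force+
  then show "subdivision (insert t T)" using assms(1) by (auto simp: subdivision_def)
  \<comment> \<open>Every knot lies on one side of the open gap between two consecutive
    knots.\<close>
  have "t \<notin> T"
  proof
    assume "t \<in> T"
    then obtain l where l: "l \<in> {1..card T}" "t = knot T l"
      using knot_image[of T] assms(1) by (metis imageE subdivision_def)
    show False
    proof (cases "l \<le> q")
      case True
      then have "knot T l \<le> knot T q" using assms(2) by (intro knot_le assms) auto
      then show ?thesis using l assms by simp
    next
      case False
      then have "knot T (q + 1) \<le> knot T l" using l by (intro knot_le assms) auto
      then show ?thesis using l assms by simp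
    qed
  qed
  then show "card (insert t T) = card T + 1" using assms(1) by (simp add: subdivision_def)
qed

text \<open>The proposed enumeration increases strictly and has image \<open>insert t T\<close>, so
  \<open>knot_eqI\<close> applies.\<close>

lemma knot_insert:
  assumes T: "subdivision T" and q: "q \<in> {1..card T - 1}" and t: "knot T q < t" "t < knot T (q + 1)"
    and j: "1 \<le> j" "j \<le> card T + 1"
  shows "knot (insert t T) j
    = (if j \<le> q then knot T j else if j = q + 1 then t else knot T (j - 1))" (is "_ = ?f j")
proof (rule knot_eqI[where f = ?f])
  note card = subdivision_insert(2)[OF T q t]
  show "finite (insert t T)" using T by (simp add: subdivision_def)
  show "?f i < ?f j" if "1 \<le> i" "i < j" "j \<le> card (insert t T)" for i j
  proof -
    \<comment> \<open>Cases by the position of \<open>i < j\<close> relative to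
      \<open>q + 1\<close>, the index of the new knot. Only those with \<open>i\<close> or
      \<open>j\<close> equal to \<open>q + 1\<close> compare \<open>t\<close> with an old
      knot.\<close>
    consider "j \<le> q" | "j = q + 1" | "q + 1 < j" "i \<le> q" | "q + 1 < j" "i = q + 1"
      | "q + 1 < i" by linarith
    then show ?thesis
    proof cases
      case 1
      then show ?thesis using that q by (auto intro!: knot_less T)
    next
      case 2
      then show ?thesis using that q t knot_le[OF T, of i q] by force
    next
      case 3
      then show ?thesis using that card by (auto intro!: knot_less T)
    next
      case 4
      have "knot T (q + 1) \<le> knot T (j - 1)" using 4 that card by (intro knot_le T) auto
      then show ?thesis using 4 t by simp
    next
      case 5
      then show ?thesis using that card by (auto intro!: knot_less T)
    qed
  qed
  have img: "knot T ` {1..card T} = T" using T knot_image by (auto simp: subdivision_def)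
  \<comment> \<open>The upper indices are written as successors because there the enumeration is
    \<open>knot T\<close> shifted by one.\<close>
  have "{1..card T + 1} = {1..q} \<union> {q + 1} \<union> Suc ` {q + 1..card T}"
    using q by (auto simp: image_Suc_atLeastAtMost)
  then have "?f ` {1..card T + 1} = ?f ` {1..q} \<union> ?f ` {q + 1} \<union> ?f ` Suc ` {q + 1..card T}"
    by (simp only: image_Un)
  also have "?f ` {1..q} = knot T ` {1..q}" by (intro image_cong) auto
  also have "?f ` Suc ` {q + 1..card T} = knot T ` {q + 1..card T}"
    unfolding image_image by (intro image_cong) auto
  also have "knot T ` {1..q} \<union> ?f ` {q + 1} \<union> knot T ` {q + 1..card T}
      = insert t (knot T ` ({1..q} \<union> {q + 1..card T}))"
    by auto
  also have "{1..q} \<union> {q + 1..card T} = {1..card T}" using q by auto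
  finally show "?f ` {1..card (insert t T)} = insert t T" using img card by simp
qed (use j subdivision_insert(2)[OF T q t] in auto)

section \<open>Integrals of hat functions\<close>

text \<open>\<open>?F\<close> is an antiderivative. The exponent stays general: 1 serves the means
  of the hats, 2 their squares, and both the product of two ramps.\<close>

lemma has_bochner_integral_ascending_ramp:
  fixes a b :: real
  assumes "a < b"
  shows "has_bochner_integral lborel
    (\<lambda>s. ((s - a) / (b - a)) ^ n * indicator {a..b} s) ((b - a) / (n + 1))"
proof -
  let ?F = "\<lambda>s. (b - a) / (n + 1) * ((s - a) / (b - a)) ^ (n + 1)"
  have "has_bochner_integral lborel
    (\<lambda>s. ((s - a) / (b - a)) ^ n * indicator {a..b} s) (?F b - ?F a)"
  proof (rule has_bochner_integral_FTC_Icc_real)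
    show "DERIV ?F s :> ((s - a) / (b - a)) ^ n" for s
    proof -
      have "DERIV (\<lambda>s. (s - a) / (b - a)) s :> 1 / (b - a)"
        using assms by (auto intro!: derivative_eq_intros)
      from DERIV_cmult[OF DERIV_power[OF this, of "n + 1"], of "(b - a) / (n + 1)"]
      have "DERIV ?F s :> (b - a) / (n + 1) * (real (n + 1) * ((s - a) / (b - a)) ^ n * (1 / (b - a)))"
        by (simp only: add_diff_cancel_right' mult_ac flip: One_nat_def)
      also have "(b - a) / (n + 1) * (real (n + 1) * ((s - a) / (b - a)) ^ n * (1 / (b - a)))
        = ((s - a) / (b - a)) ^ n"
        using assms by (simp del: of_nat_add of_nat_Suc)
      finally show ?thesis .
    qed
  qed (use assms in auto)
  then show ?thesis using assms by simp
qed

text \<open>The reflection of \<open>s\<close> to \<open>-s\<close> turns the descending ramp on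
  \<open>[a, b]\<close> into the ascending one on \<open>[-b, -a]\<close>.\<close>

lemma has_bochner_integral_descending_ramp:
  fixes a b :: real
  assumes "a < b"
  shows "has_bochner_integral lborel
    (\<lambda>s. ((b - s) / (b - a)) ^ n * indicator {a..b} s) ((b - a) / (n + 1))"
proof -
  have "has_bochner_integral lborel
      (\<lambda>s. ((s - - b) / (- a - - b)) ^ n * indicator {- b..- a} s) ((- a - - b) / (n + 1))"
    using assms by (intro has_bochner_integral_ascending_ramp) auto
  then have "has_bochner_integral lborel
      (\<lambda>s. ((0 + (-1) * s - - b) / (- a - - b)) ^ n * indicator {- b..- a} (0 + (-1) * s))
      ((- a - - b) / (n + 1) /\<^sub>R \<bar>-1\<bar>)"
    by (subst (asm) lborel_has_bochner_integral_real_affine_iff[where c = "-1" and t = 0]) auto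
  then show ?thesis by (simp add: indicator_def conj_commute)
qed

text \<open>With \<open>r = (s - a) / (b - a)\<close> the product is
  \<open>(1 - r) * r = r - r^2\<close>, and 1/2 - 1/3 = 1/6.\<close>

lemma has_bochner_integral_ramp_product:
  fixes a b :: real
  assumes "a < b"
  shows "has_bochner_integral lborel
    (\<lambda>s. (b - s) / (b - a) * ((s - a) / (b - a)) * indicator {a..b} s) ((b - a) / 6)"
proof -
  have "has_bochner_integral lborel
      (\<lambda>s. ((s - a) / (b - a)) ^ 1 * indicator {a..b} s - ((s - a) / (b - a)) ^ 2 * indicator {a..b} s)
      ((b - a) / (real 1 + 1) - (b - a) / (real 2 + 1))"
    using has_bochner_integral_ascending_ramp[OF assms, of 1]
      has_bochner_integral_ascending_ramp[OF assms, of 2]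
    by (intro has_bochner_integral_diff) auto
  moreover have "((s - a) / (b - a)) ^ 1 * indicator {a..b} s - ((s - a) / (b - a)) ^ 2 * indicator {a..b} s
      = (b - s) / (b - a) * ((s - a) / (b - a)) * indicator {a..b} s" for s
  proof -
    have "(b - s) / (b - a) = 1 - (s - a) / (b - a)" using assms by (simp add: field_simps)
    moreover have "r ^ 1 * c - r ^ 2 * c = (1 - r) * r * c" for r c :: real
      by (simp add: algebra_simps power2_eq_square)
    ultimately show ?thesis by metis
  qed
  ultimately show ?thesis by (simp add: field_simps)
qed

text \<open>The point \<open>knot T j\<close> is excluded because at an interior knot both summands are 1 there.\<close>

lemma hat_basis_power_split:
  assumes T: "subdivision T" and j: "j \<in> {1..card T}" and n: "0 < n" and s: "s \<noteq> knot T j"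
  shows "indicator {0..1} s * hat_basis T j s ^ n
    = (if j = 1 then 0 else ((s - knot T (j - 1)) / (knot T j - knot T (j - 1))) ^ n
        * indicator {knot T (j - 1)..knot T j} s)
    + (if j = card T then 0 else ((knot T (j + 1) - s) / (knot T (j + 1) - knot T j)) ^ n
        * indicator {knot T j..knot T (j + 1)} s)"
proof -
  have less: "knot T (j - 1) < knot T j" "knot T j < knot T (j + 1)"
    using j by (auto intro!: knot_less T)
  \<comment> \<open>The left ramp of the first hat lives over \<open>[-1, 0]\<close> and the right
    ramp of the last hat over \<open>[1, 2]\<close>; restriction to the unit interval leaves at most
    one point of each, so the split drops them.\<close>
  have lo: "if j = 1 then knot T j = 0 \<and> knot T (j - 1) = -1 else 0 \<le> knot T (j - 1)"
    using j knot_first[OF T] knot_in_unit_interval(1)[OF T, of "j - 1"] by (auto simp: knot_def)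
  have hi: "if j = card T then knot T j = 1 \<and> knot T (j + 1) = 2 else knot T (j + 1) \<le> 1"
    using j knot_last[OF T] knot_in_unit_interval(2)[OF T, of "j + 1"] by (auto simp: knot_def)
  \<comment> \<open>The closed interval may be opened: at the outer knot the ramp is 0 and, as
    \<open>n\<close> is positive, so is its power; the central knot is excluded by
    \<open>s\<close>.\<close>
  have asc: "((s - knot T (j - 1)) / (knot T j - knot T (j - 1))) ^ n
        * indicator {knot T (j - 1)..knot T j} s
      = (if knot T (j - 1) < s \<and> s < knot T j then hat_basis T j s ^ n else 0)"
    using s n hat_basis_ascending[OF T j, of s]
    by (cases "s = knot T (j - 1)") (auto simp: indicator_def)
  have desc: "((knot T (j + 1) - s) / (knot T (j + 1) - knot T j)) ^ n
        * indicator {knot T j..knot T (j + 1)} s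
      = (if knot T j < s \<and> s < knot T (j + 1) then hat_basis T j s ^ n else 0)"
    using s n hat_basis_descending[OF T j, of s]
    by (cases "s = knot T (j + 1)") (auto simp: indicator_def)
  have zero: "hat_basis T j s ^ n = 0" if "s \<le> knot T (j - 1) \<or> knot T (j + 1) \<le> s"
    using hat_basis_eq_0[OF T j that] n by simp
  have unit: "0 \<le> knot T j" "knot T j \<le> 1" by (rule knot_in_unit_interval[OF T j])+
  show ?thesis
  proof (cases "knot T (j - 1) < s \<and> s < knot T (j + 1)")
    case False
    then have z: "hat_basis T j s ^ n = 0" using zero by linarith
    show ?thesis unfolding asc desc z by simp
  next
    case True
    show ?thesis
    proof (cases "s < knot T j")
      case left: True
      have "s \<in> {0..1} \<longleftrightarrow> j \<noteq> 1" using left True lo unit by (cases "j = 1") auto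
      then have "indicator {0..1} s = (if j = 1 then 0 else 1 :: real)" by (simp add: indicator_def)
      moreover have "(knot T (j - 1) < s \<and> s < knot T j) = True"
        "(knot T j < s \<and> s < knot T (j + 1)) = False"
        using left True by auto
      ultimately show ?thesis unfolding asc desc by (simp only: if_True if_False) simp
    next
      case False
      then have right: "knot T j < s" using s by simp
      have "s \<in> {0..1} \<longleftrightarrow> j \<noteq> card T" using right True hi unit by (cases "j = card T") auto
      then have "indicator {0..1} s = (if j = card T then 0 else 1 :: real)" by (simp add: indicator_def)
      moreover have "(knot T (j - 1) < s \<and> s < knot T j) = False"
        "(knot T j < s \<and> s < knot T (j + 1)) = True"
        using right True by auto
      ultimately show ?thesis unfolding asc desc by (simp only: if_True if_False) simp
    qed
  qed
qed

text \<open>The split into two ramps fails at most at the central knot, a null set, so the integral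
  is the sum of those of the ramps kept.\<close>

lemma integral_hat_basis_power:
  assumes T: "subdivision T" and j: "j \<in> {1..card T}" and n: "0 < n"
  shows "(LINT s:{0..1}|lborel. hat_basis T j s ^ n)
    = (if j = 1 then 0 else (knot T j - knot T (j - 1)) / (n + 1))
    + (if j = card T then 0 else (knot T (j + 1) - knot T j) / (n + 1))"
    (is "_ = ?I")
proof -
  let ?g = "\<lambda>s. (if j = 1 then 0 else ((s - knot T (j - 1)) / (knot T j - knot T (j - 1))) ^ n
        * indicator {knot T (j - 1)..knot T j} s)
    + (if j = card T then 0 else ((knot T (j + 1) - s) / (knot T (j + 1) - knot T j)) ^ n
        * indicator {knot T j..knot T (j + 1)} s)"
  have less: "knot T (j - 1) < knot T j" "knot T j < knot T (j + 1)"
    using j by (auto intro!: knot_less T)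
  have "has_bochner_integral lborel ?g ?I"
    using has_bochner_integral_ascending_ramp[OF less(1), of n]
      has_bochner_integral_descending_ramp[OF less(2), of n]
    by (intro has_bochner_integral_add) (auto simp del: of_nat_Suc)
  note g = this
  have eq: "AE s in lborel. indicator {0..1} s * hat_basis T j s ^ n = ?g s"
    using AE_lborel_singleton[of "knot T j"]
    by eventually_elim (rule hat_basis_power_split[OF T j n])
  have "(\<lambda>s. indicator {0..1} s * hat_basis T j s ^ n) \<in> borel_measurable lborel" by measurable
  then have "(LINT s|lborel. indicator {0..1} s * hat_basis T j s ^ n) = integral\<^sup>L lborel ?g"
    using borel_measurable_has_bochner_integral[OF g] eq by (rule integral_cong_AE)
  also have "\<dots> = ?I" using g by (rule has_bochner_integral_integral_eq)
  finally show ?thesis by (simp add: set_lebesgue_integral_def)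
qed

text \<open>On the interval between their centres the two hats are complementary ramps; elsewhere
  one of them vanishes.\<close>

lemma integral_adjacent_hat_basis:
  assumes T: "subdivision T" and j: "1 \<le> j" "j + 1 \<le> card T"
  shows "(LINT s:{0..1}|lborel. hat_basis T j s * hat_basis T (j + 1) s)
    = (knot T (j + 1) - knot T j) / 6"
proof -
  let ?a = "knot T j" and ?b = "knot T (j + 1)"
  have less: "?a < ?b" using j by (auto intro!: knot_less T)
  have eq: "indicator {0..1} s * (hat_basis T j s * hat_basis T (j + 1) s)
      = (?b - s) / (?b - ?a) * ((s - ?a) / (?b - ?a)) * indicator {?a..?b} s" for s
  proof (cases "s \<in> {?a..?b}")
    case True
    have "hat_basis T j s = (?b - s) / (?b - ?a)"
      using True j by (intro hat_basis_descending T) auto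
    moreover have "hat_basis T (j + 1) s = (s - ?a) / (?b - ?a)"
      using hat_basis_ascending[OF T, of "j + 1" s] True j by simp
    moreover have "s \<in> {0..1}"
      using True j knot_in_unit_interval(1)[OF T, of j] knot_in_unit_interval(2)[OF T, of "j + 1"]
      by auto
    ultimately show ?thesis using True by simp
  next
    case False
    then have "hat_basis T j s * hat_basis T (j + 1) s = 0"
      using hat_basis_eq_0[OF T, of j s] hat_basis_eq_0[OF T, of "j + 1" s] j by auto
    then show ?thesis using False by (simp only: indicator_simps) simp
  qed
  show ?thesis
    unfolding set_lebesgue_integral_def real_scaleR_def eq
    by (rule has_bochner_integral_integral_eq[OF has_bochner_integral_ramp_product[OF less]])
qed

lemma hat_integral_eq_explicit:
  assumes T: "subdivision T" and j: "j \<in> {1..card T}"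
  shows "hat_integral T j = hat_integral_explicit T j"
proof -
  have I: "hat_integral T j = (if j = 1 then 0 else (knot T j - knot T (j - 1)) / 2)
    + (if j = card T then 0 else (knot T (j + 1) - knot T j) / 2)"
    using integral_hat_basis_power[OF T j, of 1] by (simp add: hat_integral_def)
  \<comment> \<open>A subdivision has at least two knots, so no index is both first and
    last.\<close>
  consider "j = 1" "j \<noteq> card T" | "j \<noteq> 1" "j = card T" | "j \<noteq> 1" "j \<noteq> card T"
    using card_subdivision_ge_2[OF T] by force
  then show ?thesis
  proof cases
    case 1
    have "hat_integral T j = (knot T (j + 1) - knot T j) / 2" unfolding I using 1 by simp
    then show ?thesis unfolding hat_integral_explicit_def Let_def 1(1) one_add_one
      using knot_first[OF T] by simp
  next
    case 2
    then show ?thesis unfolding I hat_integral_explicit_def Let_def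
      using knot_last[OF T] by simp
  next
    case 3
    then show ?thesis unfolding I hat_integral_explicit_def Let_def
      by (simp add: field_simps)
  qed
qed

lemma hat_integral2_commute: "hat_integral2 T j j' = hat_integral2 T j' j"
  by (simp add: hat_integral2_def mult.commute)

lemma hat_integral2_distant:
  assumes T: "subdivision T" and "j \<in> {1..card T}" "j' \<in> {1..card T}" "j + 2 \<le> j'"
  shows "hat_integral2 T j j' = 0"
proof -
  have "hat_basis T j s * hat_basis T j' s = 0" for s
  proof (cases "knot T (j + 1) \<le> s")
    case True
    then show ?thesis using hat_basis_eq_0[OF T, of j s] assms by simp
  next
    case False
    have "knot T (j + 1) \<le> knot T (j' - 1)" using assms by (intro knot_le T) auto
    then show ?thesis using False hat_basis_eq_0[OF T, of j' s] assms by simp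
  qed
  then show ?thesis by (simp only: hat_integral2_def) simp
qed

lemma hat_integral2_eq_explicit:
  assumes T: "subdivision T" and j: "j \<in> {1..card T}" and j': "j' \<in> {1..card T}"
  shows "hat_integral2 T j j' = hat_integral2_explicit T j j'"
proof -
  consider "j' = j" | "j' = j + 1" | "j = j' + 1" | "j + 2 \<le> j'" | "j' + 2 \<le> j" by linarith
  then show ?thesis
  proof cases
    case 1
    \<comment> \<open>The diagonal is the case of exponent 2 in
      \<open>integral_hat_basis_power\<close>.\<close>
    have I: "hat_integral2 T j j = (if j = 1 then 0 else (knot T j - knot T (j - 1)) / 3)
      + (if j = card T then 0 else (knot T (j + 1) - knot T j) / 3)"
      using integral_hat_basis_power[OF T j, of 2] by (simp add: hat_integral2_def power2_eq_square)
    consider "j = 1" "j \<noteq> card T" | "j \<noteq> 1" "j = card T" | "j \<noteq> 1" "j \<noteq> card T"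
      using card_subdivision_ge_2[OF T] by force
    then show ?thesis unfolding \<open>j' = j\<close> I hat_integral2_explicit_def Let_def
    proof cases
      case 1
      have "knot T (j + 1) = knot T 2" unfolding 1(1) one_add_one ..
      then show "(if j = 1 then 0 else (knot T j - knot T (j - 1)) / 3)
          + (if j = card T then 0 else (knot T (j + 1) - knot T j) / 3)
        = (if j = j then if j = 1 then (knot T 2 - knot T 1) / 3
            else if j = card T then (knot T (card T) - knot T (card T - 1)) / 3
            else (knot T (j + 1) - knot T (j - 1)) / 3
          else if j = j + 1 then (knot T (j + 1) - knot T j) / 6
          else if j = j + 1 then (knot T j - knot T (j - 1)) / 6 else 0)"
        using 1 by simp
    qed (simp_all add: diff_divide_distrib)
  next
    case 2
    then show ?thesis
      using integral_adjacent_hat_basis[OF T, of j] j j'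
      by (simp add: hat_integral2_def hat_integral2_explicit_def Let_def)
  next
    case 3
    then show ?thesis
      using integral_adjacent_hat_basis[OF T, of j'] j j' hat_integral2_commute[of T j j']
      by (simp add: hat_integral2_def hat_integral2_explicit_def Let_def)
  next
    case 4
    then show ?thesis using hat_integral2_distant[OF T j j'] by (simp add: hat_integral2_explicit_def Let_def)
  next
    case 5
    then show ?thesis
      using hat_integral2_distant[OF T j' j] hat_integral2_commute[of T j j']
      by (simp add: hat_integral2_explicit_def Let_def)
  qed
qed

section \<open>Refining a subdivision\<close>

text \<open>Both sides are piecewise linear, so they are compared on one interval of the refined
  subdivision. A computation is needed only on the two halves of the split interval, where the new
  coefficient is the value of the coarse function at \<open>t\<close>.\<close>

lemma sum_hat_basis_insert:
  fixes c :: "nat \<Rightarrow> real"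
  assumes T: "subdivision T" and q: "q \<in> {1..card T - 1}"
    and t: "knot T q < t" "t < knot T (q + 1)" and s: "s \<in> {0..1}"
  defines "r \<equiv> \<lambda>j. if j \<le> q then c j
    else if j = q + 1 then c q * ((knot T (q + 1) - t) / (knot T (q + 1) - knot T q))
      + c (q + 1) * ((t - knot T q) / (knot T (q + 1) - knot T q))
    else c (j - 1)"
  shows "(\<Sum>j = 1..card T. c j * hat_basis T j s)
    = (\<Sum>j = 1..card (insert t T). r j * hat_basis (insert t T) j s)"
proof -
  let ?U = "insert t T"
  have U: "subdivision ?U" and card: "card ?U = card T + 1"
    using subdivision_insert[OF T q t] by auto
  note knotU = knot_insert[OF T q t]
  obtain j where j: "1 \<le> j" "j + 1 \<le> card ?U" and sj: "knot ?U j \<le> s" "s \<le> knot ?U (j + 1)"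
    using obtain_knot_interval[OF U s] by blast
  note R = sum_hat_basis_interval[OF U j sj, of r]
  note L = sum_hat_basis_interval[OF T]
  \<comment> \<open>The refined interval is a coarse one left of the gap, the left half, the right
    half, or a coarse one right of the gap, whose coarse index is \<open>j - 1\<close>.\<close>
  consider "j < q" | "j = q" | "j = q + 1" | "q + 1 < j" by linarith
  then show ?thesis
  proof cases
    case 1
    then have k: "knot ?U j = knot T j" "knot ?U (j + 1) = knot T (j + 1)"
      using j q card knotU[of j] knotU[of "j + 1"] by auto
    show ?thesis
      unfolding R k using L[of j s c] 1 j q sj[unfolded k] by (simp add: r_def)
  next
    case 2
    then have k: "knot ?U j = knot T q" "knot ?U (j + 1) = t"
      using j q card knotU[of j] knotU[of "j + 1"] by auto
    have l: "(\<Sum>j = 1..card T. c j * hat_basis T j s)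
        = (c q * (knot T (q + 1) - s) + c (q + 1) * (s - knot T q)) / (knot T (q + 1) - knot T q)"
      using q t sj[unfolded k] by (intro L) auto
    have "r j = c q" "r (j + 1) = c q * ((knot T (q + 1) - t) / (knot T (q + 1) - knot T q))
      + c (q + 1) * ((t - knot T q) / (knot T (q + 1) - knot T q))"
      using 2 by (auto simp: r_def)
    \<comment> \<open>Replacing the right end of a segment by one of its inner points leaves the
      line unchanged.\<close>
    moreover have "(x * (b - s) + y * (s - a)) / (b - a)
      = (x * (t - s) + (x * ((b - t) / (b - a)) + y * ((t - a) / (b - a))) * (s - a)) / (t - a)"
      if "a < t" "t < b" for x y a b :: real
    proof -
      have "t - a \<noteq> 0" "b - a \<noteq> 0" using that by auto
      then show ?thesis by (simp add: divide_simps) (simp add: algebra_simps)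
    qed
    ultimately show ?thesis unfolding R k l using t by metis
  next
    case 3
    then have k: "knot ?U j = t" "knot ?U (j + 1) = knot T (q + 1)"
      using j q card knotU[of j] knotU[of "j + 1"] by auto
    have l: "(\<Sum>j = 1..card T. c j * hat_basis T j s)
        = (c q * (knot T (q + 1) - s) + c (q + 1) * (s - knot T q)) / (knot T (q + 1) - knot T q)"
      using q t sj[unfolded k] by (intro L) auto
    have "r (j + 1) = c (q + 1)" "r j = c q * ((knot T (q + 1) - t) / (knot T (q + 1) - knot T q))
      + c (q + 1) * ((t - knot T q) / (knot T (q + 1) - knot T q))"
      using 3 by (auto simp: r_def)
    moreover have "(x * (b - s) + y * (s - a)) / (b - a)
      = ((x * ((b - t) / (b - a)) + y * ((t - a) / (b - a))) * (b - s) + y * (s - t)) / (b - t)"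
      if "a < t" "t < b" for x y a b :: real
    proof -
      have "b - t \<noteq> 0" "b - a \<noteq> 0" using that by auto
      then show ?thesis by (simp add: divide_simps) (simp add: algebra_simps)
    qed
    ultimately show ?thesis unfolding R k l using t by metis
  next
    case 4
    then have k: "knot ?U j = knot T (j - 1)" "knot ?U (j + 1) = knot T j"
      using j q card knotU[of j] knotU[of "j + 1"] by auto
    have "r j = c (j - 1)" "r (j + 1) = c j" using 4 by (auto simp: r_def)
    then show ?thesis
      unfolding R k using L[of "j - 1" s c] 4 j card sj[unfolded k] by simp
  qed
qed

section \<open>Integrals of linear combinations of hats and of their squares\<close>

lemma set_integrable_hat_basis:
  assumes "subdivision T" "j \<in> {1..card T}"
  shows "set_integrable lborel {0..1} (hat_basis T j)"
  unfolding set_integrable_def real_scaleR_def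
proof (rule integrableI_bounded_set[where A = "{0..1}" and B = 1])
  show "AE s in lborel. s \<in> {0..1} \<longrightarrow> norm (indicator {0..1} s * hat_basis T j s) \<le> 1"
    using hat_basis_bounds[OF assms] by (auto simp: abs_mult)
qed (auto simp: indicator_def)

lemma set_integrable_hat_basis_mult:
  assumes "subdivision T" "j \<in> {1..card T}" "j' \<in> {1..card T}"
  shows "set_integrable lborel {0..1} (\<lambda>s. hat_basis T j s * hat_basis T j' s)"
  unfolding set_integrable_def real_scaleR_def
proof (rule integrableI_bounded_set[where A = "{0..1}" and B = 1])
  show "AE s in lborel. s \<in> {0..1}
      \<longrightarrow> norm (indicator {0..1} s * (hat_basis T j s * hat_basis T j' s)) \<le> 1"
    using hat_basis_bounds[OF assms(1,2)] hat_basis_bounds[OF assms(1,3)]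
    by (auto simp: abs_mult intro!: mult_le_one)
qed (auto simp: indicator_def)

lemma set_integrable_sum:
  fixes f :: "'i \<Rightarrow> 'a \<Rightarrow> 'b::{banach, second_countable_topology}"
  assumes "\<And>i. i \<in> I \<Longrightarrow> set_integrable M A (f i)"
  shows "set_integrable M A (\<lambda>x. \<Sum>i\<in>I. f i x)"
  using assms unfolding set_integrable_def scaleR_sum_right by (rule Bochner_Integration.integrable_sum)

lemma set_lebesgue_integral_sum:
  fixes f :: "'i \<Rightarrow> 'a \<Rightarrow> 'b::{banach, second_countable_topology}"
  assumes "\<And>i. i \<in> I \<Longrightarrow> set_integrable M A (f i)"
  shows "(LINT x:A|M. \<Sum>i\<in>I. f i x) = (\<Sum>i\<in>I. LINT x:A|M. f i x)"
  using assms unfolding set_integrable_def set_lebesgue_integral_def scaleR_sum_right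
  by (rule Bochner_Integration.integral_sum)

lemma sum_hat_basis_square:
  "(\<Sum>j = 1..card T. c j * hat_basis T j s)\<^sup>2
    = (\<Sum>j = 1..card T. \<Sum>j' = 1..card T. c j * c j' * (hat_basis T j s * hat_basis T j' s))"
  unfolding power2_eq_square sum_product by (intro sum.cong refl) (simp add: mult_ac)

lemma set_integrable_sum_hat_basis:
  assumes "subdivision T"
  shows "set_integrable lborel {0..1} (\<lambda>s. \<Sum>j = 1..card T. c j * hat_basis T j s)"
  using set_integrable_hat_basis[OF assms]
  by (intro set_integrable_sum set_integrable_mult_right) auto

lemma set_integrable_sum_hat_basis_square:
  assumes "subdivision T"
  shows "set_integrable lborel {0..1} (\<lambda>s. (\<Sum>j = 1..card T. c j * hat_basis T j s)\<^sup>2)"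
  unfolding sum_hat_basis_square using set_integrable_hat_basis_mult[OF assms]
  by (intro set_integrable_sum set_integrable_mult_right) auto

lemma integral_sum_hat_basis:
  assumes "subdivision T"
  shows "(LINT s:{0..1}|lborel. \<Sum>j = 1..card T. c j * hat_basis T j s)
    = (\<Sum>j = 1..card T. c j * hat_integral T j)"
  using set_integrable_hat_basis[OF assms]
  by (subst set_lebesgue_integral_sum) (auto intro!: set_integrable_mult_right simp: hat_integral_def)

text \<open>The square expands into a full double sum; pairs at distance at least 2 integrate to
  zero, which leaves the tridiagonal band.\<close>

lemma integral_sum_hat_basis_square:
  assumes T: "subdivision T"
  shows "(LINT s:{0..1}|lborel. (\<Sum>j = 1..card T. c j * hat_basis T j s)\<^sup>2)
    = (\<Sum>(j, j') \<in> {(j, j'). j \<in> {1..card T} \<and> j' \<in> {1..card T} \<and> \<bar>int j - int j'\<bar> \<le> 1}.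
        c j * c j' * hat_integral2 T j j')"
proof -
  have "(LINT s:{0..1}|lborel. (\<Sum>j = 1..card T. c j * hat_basis T j s)\<^sup>2)
      = (\<Sum>j = 1..card T. \<Sum>j' = 1..card T. c j * c j' * hat_integral2 T j j')"
  proof -
    have int: "set_integrable lborel {0..1} (\<lambda>s. c j * c j' * (hat_basis T j s * hat_basis T j' s))"
      if "j \<in> {1..card T}" "j' \<in> {1..card T}" for j j'
      using set_integrable_hat_basis_mult[OF T that] by (rule set_integrable_mult_right)
    have "(LINT s:{0..1}|lborel. \<Sum>j' = 1..card T. c j * c j' * (hat_basis T j s * hat_basis T j' s))
        = (\<Sum>j' = 1..card T. c j * c j' * hat_integral2 T j j')" if "j \<in> {1..card T}" for j
      using int[OF that] by (subst set_lebesgue_integral_sum) (auto simp: hat_integral2_def)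
    then show ?thesis
      unfolding sum_hat_basis_square using int
      by (subst set_lebesgue_integral_sum) (auto intro!: set_integrable_sum)
  qed
  also have "\<dots> = (\<Sum>(j, j') \<in> {1..card T} \<times> {1..card T}. c j * c j' * hat_integral2 T j j')"
    by (rule sum.cartesian_product)
  also have "\<dots> = (\<Sum>(j, j') \<in> {(j, j'). j \<in> {1..card T} \<and> j' \<in> {1..card T}
      \<and> \<bar>int j - int j'\<bar> \<le> 1}. c j * c j' * hat_integral2 T j j')"
  proof (rule sum.mono_neutral_right)
    show "\<forall>p\<in>{1..card T} \<times> {1..card T} - {(j, j'). j \<in> {1..card T} \<and> j' \<in> {1..card T}
        \<and> \<bar>int j - int j'\<bar> \<le> 1}. (case p of (j, j') \<Rightarrow> c j * c j' * hat_integral2 T j j') = 0"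
    proof
      fix p assume p: "p \<in> {1..card T} \<times> {1..card T} - {(j, j'). j \<in> {1..card T}
        \<and> j' \<in> {1..card T} \<and> \<bar>int j - int j'\<bar> \<le> 1}"
      obtain j j' where jj: "p = (j, j')" by fastforce
      then have j: "j \<in> {1..card T}" "j' \<in> {1..card T}" and "\<not> \<bar>int j - int j'\<bar> \<le> 1"
        using p by auto
      then have "j + 2 \<le> j' \<or> j' + 2 \<le> j" by auto
      then have "hat_integral2 T j j' = 0"
        using hat_integral2_distant[OF T j] hat_integral2_distant[OF T j(2,1)]
          hat_integral2_commute[of T j j'] by auto
      then show "(case p of (j, j') \<Rightarrow> c j * c j' * hat_integral2 T j j') = 0" using jj by simp
    qed
  qed auto
  finally show ?thesis .
qed

text \<open>Only the summand of \<open>istar\<close> changes its basis, and there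
  \<open>sum_hat_basis_insert\<close> applies at the coordinate \<open>x istar\<close>.\<close>

lemma mode_fun_insert:
  assumes S: "\<And>i. i \<in> A \<Longrightarrow> subdivision (S i)" and star: "istar \<in> A"
    and nu: "nu \<in> {1..card (S istar) - 1}"
    and t: "knot (S istar) nu < t" "t < knot (S istar) (nu + 1)"
    and x: "\<And>i. i \<in> A \<Longrightarrow> x i \<in> {0..1}"
  shows "mode_fun A S xi x = mode_fun A (S(istar := insert t (S istar)))
    (\<lambda>i j. if i \<noteq> istar then xi i j
      else if j \<le> nu then xi i j
      else if j = nu + 1 then
        xi istar nu * ((knot (S istar) (nu + 1) - t)
          / (knot (S istar) (nu + 1) - knot (S istar) nu))
        + xi istar (nu + 1) * ((t - knot (S istar) nu)
          / (knot (S istar) (nu + 1) - knot (S istar) nu))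
      else xi i (j - 1)) x"
  unfolding mode_fun_def
proof (rule sum.cong[OF refl], goal_cases)
  case (1 i)
  show ?case
  proof (cases "i = istar")
    case True
    show ?thesis
      using sum_hat_basis_insert[OF S[OF star] nu t x[OF star], of "xi istar"]
      unfolding True by (simp only: fun_upd_same simp_thms if_False)
  next
    case False
    then show ?thesis by simp
  qed
qed

section \<open>Integral of the square of an additive function\<close>

text \<open>The square times the indicator of the cube is a double sum of products of one-variable
  functions, so each term integrates to a product of integrals. A diagonal pair gives
  \<open>v p\<close> instead of \<open>(m p)^2\<close>, whence the correction by the sum of squared
  means.\<close>

lemma integral_square_additive:
  fixes g :: "'i \<Rightarrow> real \<Rightarrow> real"
  assumes A: "finite A"
    and int: "\<And>i. i \<in> A \<Longrightarrow> set_integrable lborel {0..1} (g i)"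
    and int2: "\<And>i. i \<in> A \<Longrightarrow> set_integrable lborel {0..1} (\<lambda>s. (g i s)\<^sup>2)"
  shows "(LINT x:(\<Pi>\<^sub>E i\<in>A. {0..1})|(\<Pi>\<^sub>M i\<in>A. lborel). (\<Sum>i\<in>A. g i (x i))\<^sup>2)
    = (\<Sum>i\<in>A. LINT s:{0..1}|lborel. (g i s)\<^sup>2) - (\<Sum>i\<in>A. (LINT s:{0..1}|lborel. g i s)\<^sup>2)
      + (\<Sum>i\<in>A. LINT s:{0..1}|lborel. g i s)\<^sup>2"
proof -
  interpret product_sigma_finite "\<lambda>_ :: 'i. lborel :: real measure" by standard
  define m where "m i = (LINT s:{0..1}|lborel. g i s)" for i
  define v where "v i = (LINT s:{0..1}|lborel. (g i s)\<^sup>2)" for i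
  \<comment> \<open>\<open>F p q i\<close> is the factor of coordinate \<open>i\<close> in the term
    \<open>g p (x p) * g q (x q)\<close>, with the indicator of the cube spread over all
    coordinates. For \<open>i\<close> other than \<open>p\<close> and \<open>q\<close> it integrates
    to 1.\<close>
  define F :: "'i \<Rightarrow> 'i \<Rightarrow> 'i \<Rightarrow> real \<Rightarrow> real" where "F p q i s =
    indicator {0..1} s * ((if i = p then g p s else 1) * (if i = q then g q s else 1))" for p q i s
  have F: "has_bochner_integral lborel (F p q i)
      (if i = p then if i = q then v p else m p else if i = q then m q else 1)"
    if "p \<in> A" "q \<in> A" for p q i
  proof -
    have 1: "has_bochner_integral lborel (indicator {0..1} :: real \<Rightarrow> real) 1"
      using has_bochner_integral_real_indicator[of "{0..1::real}" lborel] by simp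
    have 2: "has_bochner_integral lborel (\<lambda>s. indicator {0..1} s * g p s) (m p)" if "p \<in> A" for p
      using int[OF that] by (simp add: has_bochner_integral_iff set_integrable_def m_def
          set_lebesgue_integral_def)
    have 3: "has_bochner_integral lborel (\<lambda>s. indicator {0..1} s * (g p s * g p s)) (v p)"
      using int2[OF that(1)] by (simp add: has_bochner_integral_iff set_integrable_def v_def
          set_lebesgue_integral_def power2_eq_square)
    show ?thesis using 1 2[OF that(1)] 2[OF that(2)] 3
      by (auto simp: F_def[abs_def])
  qed
  have Fint: "integrable lborel (F p q i)" if "p \<in> A" "q \<in> A" for p q i
    using F[OF that] by (rule integrable.intros)
  \<comment> \<open>One formula for both cases: the first summand sums to the square of the total
    mean, the second to the diagonal correction.\<close>
  have prodF: "(\<Prod>i\<in>A. integral\<^sup>L lborel (F p q i)) = m p * m q + (if p = q then v p - (m p)\<^sup>2 else 0)"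
    if "p \<in> A" "q \<in> A" for p q
  proof -
    have "(\<Prod>i\<in>A. integral\<^sup>L lborel (F p q i))
        = (\<Prod>i\<in>A. if i = p then if i = q then v p else m p else if i = q then m q else 1)"
      by (intro prod.cong refl has_bochner_integral_integral_eq[OF F[OF that]])
    also have "\<dots> = (if p = q then v p else m p * m q)"
    proof (cases "p = q")
      case True
      then have "(\<Prod>i\<in>A. if i = p then if i = q then v p else m p else if i = q then m q else 1)
        = (\<Prod>i\<in>A. if i = p then v p else 1)"
        by (intro prod.cong) auto
      then show ?thesis using True A that by (simp add: prod.delta)
    next
      case False
      then have "(\<Prod>i\<in>A. if i = p then if i = q then v p else m p else if i = q then m q else 1)
        = (\<Prod>i\<in>A. (if i = p then m p else 1) * (if i = q then m q else 1))"
        by (intro prod.cong) auto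
      then show ?thesis using False A that by (simp add: prod.distrib prod.delta)
    qed
    finally show ?thesis by (simp add: power2_eq_square)
  qed
  have pointwise: "indicator (\<Pi>\<^sub>E i\<in>A. {0..1}) x *\<^sub>R (\<Sum>i\<in>A. g i (x i))\<^sup>2
      = (\<Sum>p\<in>A. \<Sum>q\<in>A. \<Prod>i\<in>A. F p q i (x i))"
    if "x \<in> space (\<Pi>\<^sub>M i\<in>A. lborel :: real measure)" for x
  proof -
    \<comment> \<open>Points of the product space are extensional, so membership in the cube depends
      on the coordinates in \<open>A\<close> alone and its indicator factorizes.\<close>
    have "x \<in> extensional A" using that by (auto simp: space_PiM PiE_def)
    then have ind: "indicator (\<Pi>\<^sub>E i\<in>A. {0..1}) x = (\<Prod>i\<in>A. indicator {0..1} (x i) :: real)"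
      using A by (cases "x \<in> (\<Pi>\<^sub>E i\<in>A. {0..1})")
        (auto simp: PiE_def Pi_def indicator_def prod_zero_iff cong: prod.cong)
    have "(\<Prod>i\<in>A. F p q i (x i)) = (\<Prod>i\<in>A. indicator {0..1} (x i)) * (g p (x p) * g q (x q))"
      if "p \<in> A" "q \<in> A" for p q
    proof -
      have "(\<Prod>i\<in>A. if i = p then g p (x i) else 1) = g p (x p)" if "p \<in> A" for p
      proof -
        have "(\<Prod>i\<in>A. if i = p then g p (x i) else 1) = (\<Prod>i\<in>A. if i = p then g p (x p) else 1)"
          by (intro prod.cong) auto
        then show ?thesis using A that by (simp add: prod.delta)
      qed
      then show ?thesis using that unfolding F_def by (simp add: prod.distrib)
    qed
    then show ?thesis
      by (simp add: ind power2_eq_square sum_product flip: sum_distrib_left)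
  qed
  have "(LINT x:(\<Pi>\<^sub>E i\<in>A. {0..1})|(\<Pi>\<^sub>M i\<in>A. lborel). (\<Sum>i\<in>A. g i (x i))\<^sup>2)
      = (LINT x|(\<Pi>\<^sub>M i\<in>A. lborel). (\<Sum>p\<in>A. \<Sum>q\<in>A. \<Prod>i\<in>A. F p q i (x i)))"
    unfolding set_lebesgue_integral_def by (intro Bochner_Integration.integral_cong refl pointwise)
  also have "\<dots> = (\<Sum>p\<in>A. \<Sum>q\<in>A. LINT x|(\<Pi>\<^sub>M i\<in>A. lborel). (\<Prod>i\<in>A. F p q i (x i)))"
    using A Fint
    by (simp add: Bochner_Integration.integral_sum Bochner_Integration.integrable_sum product_integrable_prod)
  also have "\<dots> = (\<Sum>p\<in>A. \<Sum>q\<in>A. \<Prod>i\<in>A. integral\<^sup>L lborel (F p q i))"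
    using A Fint by (intro sum.cong refl product_integral_prod) auto
  also have "\<dots> = (\<Sum>p\<in>A. \<Sum>q\<in>A. m p * m q + (if p = q then v p - (m p)\<^sup>2 else 0))"
    by (intro sum.cong refl prodF)
  also have "\<dots> = (\<Sum>p\<in>A. v p) - (\<Sum>p\<in>A. (m p)\<^sup>2) + (\<Sum>p\<in>A. m p)\<^sup>2"
    using A by (simp add: sum.distrib sum.delta' sum_subtractf power2_eq_square[of "\<Sum>p\<in>A. m p"] sum_product)
  finally show ?thesis by (simp add: m_def v_def)
qed

section \<open>Value and cost of the expression\<close>

text \<open>Relates the window loop of \<open>mode_distance_expr\<close> to the band of index pairs.
  For \<open>j = 1\<close> the window starts at 0 and for \<open>j = M\<close> it ends at
  \<open>M + 1\<close>; the guards discard these values.\<close>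

lemma sum_neighbours:
  fixes f :: "nat \<Rightarrow> nat \<Rightarrow> real"
  shows "(\<Sum>j = 1..M. \<Sum>j' = j - 1..j + 1. if 1 \<le> j' then if j' \<le> M then f j j' else 0 else 0)
    = (\<Sum>(j, j') \<in> {(j, j'). j \<in> {1..M} \<and> j' \<in> {1..M} \<and> \<bar>int j - int j'\<bar> \<le> 1}. f j j')"
proof -
  have "(\<Sum>j' = j - 1..j + 1. if 1 \<le> j' then if j' \<le> M then f j j' else 0 else 0)
      = (\<Sum>j' \<in> {j' \<in> {1..M}. \<bar>int j - int j'\<bar> \<le> 1}. f j j')" for j
    by (rule sum.mono_neutral_cong_right) auto
  moreover have "(SIGMA j:{1..M}. {j' \<in> {1..M}. \<bar>int j - int j'\<bar> \<le> 1})
      = {(j, j'). j \<in> {1..M} \<and> j' \<in> {1..M} \<and> \<bar>int j - int j'\<bar> \<le> 1}"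
    by auto
  ultimately show ?thesis by (simp add: sum.Sigma)
qed

section \<open>Value of the expression\<close>

context
  fixes B :: "nat set" and R Rt :: "nat \<Rightarrow> real set" and p q :: nat and s :: real
    and f g :: "nat \<Rightarrow> nat \<Rightarrow> real" and inp :: eval_input
  defines "Rt \<equiv> R(p := insert s (R p))"
    and "inp \<equiv> mode_distance_input B R p q s f g"
begin

lemma in_size_mode_distance_input: "in_size inp i = card (Rt i)"
  by (simp add: inp_def mode_distance_input_def Let_def Rt_def)

lemma in_active_mode_distance_input: "in_active inp = B"
  by (simp add: inp_def mode_distance_input_def Let_def)

lemma expr_val_eta_bar_expr:
  "expr_val inp (eta_bar_expr (Loop a) (Loop b)) env =
    (let i = env a; j = env b in
      (if i \<noteq> p then f i j
       else if j \<le> q then f i j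
       else if j = q + 1 then
         f p q * ((knot (R p) (q + 1) - s) / (knot (R p) (q + 1) - knot (R p) q))
         + f p (q + 1) * ((s - knot (R p) q) / (knot (R p) (q + 1) - knot (R p) q))
       else f i (j - 1)) - g i j)"
  by (simp add: inp_def mode_distance_input_def eta_bar_expr_def xi_bar_expr_def Let_def)

lemma expr_val_hat_integral_expr:
  "expr_val inp (hat_integral_expr (Loop a) (Loop b)) env = hat_integral_explicit (Rt (env a)) (env b)"
  by (simp add: inp_def mode_distance_input_def hat_integral_expr_def hat_integral_explicit_def Let_def
      Rt_def)

lemma expr_val_hat_integral2_expr:
  "expr_val inp (hat_integral2_expr (Loop a) (Loop b) (Loop c)) env
    = hat_integral2_explicit (Rt (env a)) (env b) (env c)"
  by (simp add: inp_def mode_distance_input_def hat_integral2_expr_def hat_integral2_explicit_def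
      Let_def Rt_def)

text \<open>Each subexpression evaluates to its mathematical counterpart in every environment;
  \<open>sum_neighbours\<close> then turns the nested loops into the banded sum.\<close>

lemma expr_val_mode_distance_expr:
  assumes eta: "\<And>i j. eta i j =
      (if i \<noteq> p then f i j
       else if j \<le> q then f i j
       else if j = q + 1 then
         f p q * ((knot (R p) (q + 1) - s) / (knot (R p) (q + 1) - knot (R p) q))
         + f p (q + 1) * ((s - knot (R p) q) / (knot (R p) (q + 1) - knot (R p) q))
       else f i (j - 1)) - g i j"
  shows "expr_val inp mode_distance_expr env =
    (\<Sum>i\<in>B. \<Sum>(j, j') \<in> {(j, j'). j \<in> {1..card (Rt i)} \<and> j' \<in> {1..card (Rt i)}
        \<and> \<bar>int j - int j'\<bar> \<le> 1}.
      eta i j * eta i j' * hat_integral2_explicit (Rt i) j j')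
    - (\<Sum>i\<in>B. (\<Sum>j = 1..card (Rt i). eta i j * hat_integral_explicit (Rt i) j)\<^sup>2)
    + (\<Sum>i\<in>B. \<Sum>j = 1..card (Rt i). eta i j * hat_integral_explicit (Rt i) j)\<^sup>2"
proof -
  have eta_val: "expr_val inp (eta_bar_expr (Loop a) (Loop b)) env = eta (env a) (env b)" for a b env
    unfolding expr_val_eta_bar_expr eta Let_def ..
  show ?thesis
    unfolding sum_neighbours[symmetric] mode_distance_expr_def Let_def
    by (simp add: eta_val expr_val_hat_integral_expr expr_val_hat_integral2_expr
        in_active_mode_distance_input in_size_mode_distance_input cong: if_cong)
qed

end

section \<open>Bounds for the cost of the expression\<close>

lemma expr_cost_Sum_active_le:
  assumes "\<And>i. i \<in> in_active inp \<Longrightarrow> expr_cost inp e (env(v := i)) \<le> K i"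
  shows "expr_cost inp (Sum_active v e) env \<le> 1 + (\<Sum>i\<in>in_active inp. 1 + K i)"
proof -
  have "(\<Sum>i\<in>in_active inp. 1 + expr_cost inp e (env(v := i))) \<le> (\<Sum>i\<in>in_active inp. 1 + K i)"
    by (intro sum_mono add_mono order_refl assms)
  then show ?thesis by simp
qed

lemma expr_cost_Sum_range_le:
  assumes "\<And>j. expr_cost inp e (env(v := j)) \<le> K"
  shows "expr_cost inp (Sum_range v a b e) env
    \<le> 1 + index_cost a + index_cost b + (index_val inp b env + 1 - index_val inp a env) * (1 + K)"
proof -
  have "(\<Sum>j = index_val inp a env..index_val inp b env. 1 + expr_cost inp e (env(v := j)))
      \<le> (\<Sum>j = index_val inp a env..index_val inp b env. 1 + K)"
    by (intro sum_mono add_mono order_refl assms)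
  also have "\<dots> = (index_val inp b env + 1 - index_val inp a env) * (1 + K)" by simp
  finally show ?thesis by simp
qed

text \<open>The costliest branch is the interpolation at the new knot; 60 is its cost rounded up.
  What matters is that the bound is independent of the input.\<close>

lemma expr_cost_eta_bar_expr_le: "expr_cost inp (eta_bar_expr (Loop a) (Loop b)) env \<le> 60"
  by (simp add: eta_bar_expr_def xi_bar_expr_def Let_def)

lemma expr_cost_hat_integral_expr_le: "expr_cost inp (hat_integral_expr (Loop a) (Loop b)) env \<le> 50"
  by (simp add: hat_integral_expr_def)

lemma expr_cost_hat_integral2_expr_le:
  "expr_cost inp (hat_integral2_expr (Loop a) (Loop b) (Loop c)) env \<le> 50"
  by (simp add: hat_integral2_expr_def)

text \<open>The window loop makes at most three iterations, so its cost is bounded by a constant and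
  every variable costs at most a multiple of its number of knots plus a constant. All constants are
  rounded up.\<close>

lemma expr_cost_mode_distance_expr_le:
  "expr_cost inp mode_distance_expr env \<le> 6 + (\<Sum>i\<in>in_active inp. 30 + 1000 * in_size inp i)"
proof -
  let ?i = "Loop Var_i" and ?j = "Loop Var_j" and ?k = "Loop Var_j2"
  let ?linear = "Times (eta_bar_expr ?i ?j) (hat_integral_expr ?i ?j)"
  let ?quad = "Cond (Le (Num 1) ?k) (Cond (Le ?k (Size ?i))
    (Times (Times (eta_bar_expr ?i ?j) (eta_bar_expr ?i ?k)) (hat_integral2_expr ?i ?j ?k))
    (Const 0)) (Const 0)"
  let ?linear_sum = "Sum_range Var_j (Num 1) (Size ?i) ?linear"
  let ?inner = "Sum_range Var_j2 (Pred ?j) (Succ ?j) ?quad"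
  let ?quad_sum = "Sum_range Var_j (Num 1) (Size ?i) ?inner"
  have linear: "expr_cost inp ?linear env \<le> 120" for env
    using expr_cost_eta_bar_expr_le[of inp Var_i Var_j env]
      expr_cost_hat_integral_expr_le[of inp Var_i Var_j env] by simp
  have quad: "expr_cost inp ?quad env \<le> 190" for env
    using expr_cost_eta_bar_expr_le[of inp Var_i Var_j env]
      expr_cost_eta_bar_expr_le[of inp Var_i Var_j2 env]
      expr_cost_hat_integral2_expr_le[of inp Var_i Var_j Var_j2 env] by simp
  have inner: "expr_cost inp ?inner env \<le> 600" for env
  proof -
    have "expr_cost inp ?inner env
        \<le> 1 + index_cost (Pred ?j) + index_cost (Succ ?j)
          + (index_val inp (Succ ?j) env + 1 - index_val inp (Pred ?j) env) * (1 + 190)"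
      by (intro expr_cost_Sum_range_le quad)
    \<comment> \<open>The number of iterations is \<open>j + 2 - (j - 1)\<close>, which is 3, or 2
      when \<open>j = 0\<close> because of truncated subtraction.\<close>
    moreover have "(index_val inp (Succ ?j) env + 1 - index_val inp (Pred ?j) env) * (1 + 190)
        \<le> 3 * (1 + 190)"
      by (intro mult_right_mono) auto
    ultimately show ?thesis by simp
  qed
  have linear_sum: "expr_cost inp ?linear_sum (env(Var_i := i)) \<le> 4 + 121 * in_size inp i" for env i
    using expr_cost_Sum_range_le[of inp ?linear "env(Var_i := i)" Var_j 120 "Num 1" "Size ?i"] linear
    by simp
  have quad_sum: "expr_cost inp ?quad_sum (env(Var_i := i)) \<le> 4 + 601 * in_size inp i" for env i
    using expr_cost_Sum_range_le[of inp ?inner "env(Var_i := i)" Var_j 600 "Num 1" "Size ?i"] inner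
    by (simp del: expr_cost.simps(11))
  have square: "expr_cost inp (Square ?linear_sum) (env(Var_i := i)) \<le> 5 + 121 * in_size inp i"
    for env i
    using linear_sum[of env i] by simp
  have "expr_cost inp (Sum_active Var_i ?quad_sum) env
      \<le> 1 + (\<Sum>i\<in>in_active inp. 1 + (4 + 601 * in_size inp i))"
    "expr_cost inp (Sum_active Var_i (Square ?linear_sum)) env
      \<le> 1 + (\<Sum>i\<in>in_active inp. 1 + (5 + 121 * in_size inp i))"
    "expr_cost inp (Sum_active Var_i ?linear_sum) env
      \<le> 1 + (\<Sum>i\<in>in_active inp. 1 + (4 + 121 * in_size inp i))"
    by (intro expr_cost_Sum_active_le quad_sum square linear_sum)+
  \<comment> \<open>The 3 counts \<open>Plus\<close>, \<open>Minus\<close> and the outer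
    \<open>Square\<close>. The cost equation of \<open>Square\<close> is instantiated so that the
    inner square stays folded for its own bound.\<close>
  moreover have "expr_cost inp mode_distance_expr env
      = 3 + expr_cost inp (Sum_active Var_i ?quad_sum) env
        + expr_cost inp (Sum_active Var_i (Square ?linear_sum)) env
        + expr_cost inp (Sum_active Var_i ?linear_sum) env"
    unfolding mode_distance_expr_def Let_def
    by (simp only: expr_cost.simps(4) expr_cost.simps(5) expr_cost.simps(8)
        [where e = "Sum_active Var_i ?linear_sum"])
  moreover have "(\<Sum>i\<in>in_active inp. 1 + (4 + 601 * in_size inp i))
      + (\<Sum>i\<in>in_active inp. 1 + (5 + 121 * in_size inp i))
      + (\<Sum>i\<in>in_active inp. 1 + (4 + 121 * in_size inp i))
      \<le> (\<Sum>i\<in>in_active inp. 30 + 1000 * in_size inp i)"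
    unfolding sum.distrib[symmetric] by (intro sum_mono) simp
  ultimately show ?thesis by linarith
qed

text \<open>The last of the three sums alone makes one iteration per knot. Together with the upper
  bound this makes the cost linear from both sides.\<close>

lemma expr_cost_mode_distance_expr_ge:
  "(\<Sum>i\<in>in_active inp. in_size inp i) \<le> expr_cost inp mode_distance_expr env"
proof -
  have "in_size inp i \<le> expr_cost inp (Sum_range Var_j (Num 1) (Size (Loop Var_i)) e) (env(Var_i := i))"
    for e env i
  proof -
    have "in_size inp i = (\<Sum>j = 1..in_size inp i. 1)" by simp
    also have "\<dots> \<le> (\<Sum>j = 1..in_size inp i. 1 + expr_cost inp e (env(Var_i := i, Var_j := j)))"
      by (intro sum_mono) simp
    finally show ?thesis by simp
  qed
  then have "(\<Sum>i\<in>in_active inp. in_size inp i)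
      \<le> expr_cost inp (Sum_active Var_i (Sum_range Var_j (Num 1) (Size (Loop Var_i)) e)) env" for e
    unfolding expr_cost.simps(10) by (intro trans_le_add2 sum_mono) (simp add: trans_le_add2 del: expr_cost.simps)
  then show ?thesis
    unfolding mode_distance_expr_def Let_def expr_cost.simps(4) expr_cost.simps(8)
    by (metis trans_le_add2 le_SucI plus_1_eq_Suc)
qed

text \<open>The loops run over refined sizes, which exceed the original ones by one knot at most,
  for \<open>p\<close> only.\<close>

lemma mode_distance_cost_linear:
  assumes B: "finite B" and R: "\<And>i. i \<in> B \<Longrightarrow> subdivision (R i)" and p: "p \<in> B"
    and q: "q \<in> {1..card (R p) - 1}" and s: "knot (R p) q < s" "s < knot (R p) (q + 1)"
  shows "(\<Sum>i\<in>B. card (R i)) \<le> expr_cost (mode_distance_input B R p q s f g) mode_distance_expr env"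
    and "expr_cost (mode_distance_input B R p q s f g) mode_distance_expr env
      \<le> 3000 * (\<Sum>i\<in>B. card (R i))"
proof -
  let ?inp = "mode_distance_input B R p q s f g"
  have size: "card (R i) \<le> in_size ?inp i" "in_size ?inp i \<le> card (R i) + 1" if "i \<in> B" for i
    using that subdivision_insert(2)[OF R[OF p] q s]
    by (auto simp: in_size_mode_distance_input)
  have "(\<Sum>i\<in>B. card (R i)) \<le> (\<Sum>i\<in>B. in_size ?inp i)"
    by (intro sum_mono size)
  then show "(\<Sum>i\<in>B. card (R i)) \<le> expr_cost ?inp mode_distance_expr env"
    using expr_cost_mode_distance_expr_ge[of ?inp env]
    by (simp add: in_active_mode_distance_input)
  have card: "2 \<le> card (R i)" if "i \<in> B" for i using card_subdivision_ge_2[OF R[OF that]] .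
  \<comment> \<open>Having at least two knots per variable lets \<open>1000 * card (R i)\<close>
    absorb 1030, the additive constant after the possible new knot. The remaining 6 is absorbed
    below, as \<open>B\<close> contains \<open>p\<close>; this gives 2000 + 1000 = 3000.\<close>
  have "(\<Sum>i\<in>B. 30 + 1000 * in_size ?inp i) \<le> (\<Sum>i\<in>B. 2000 * card (R i))"
  proof (intro sum_mono)
    fix i assume "i \<in> B"
    then show "30 + 1000 * in_size ?inp i \<le> 2000 * card (R i)" using size(2)[of i] card[of i] by simp
  qed
  moreover have "6 \<le> 1000 * (\<Sum>i\<in>B. card (R i))"
    using member_le_sum[OF p, of "\<lambda>i. card (R i)"] B card[OF p] by simp
  ultimately show "expr_cost ?inp mode_distance_expr env \<le> 3000 * (\<Sum>i\<in>B. card (R i))"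
    using expr_cost_mode_distance_expr_le[of ?inp env]
    by (simp add: in_active_mode_distance_input sum_distrib_left[symmetric])
qed

section \<open>Distance between the coarse and the refined mode\<close>

theorem proposition2:
  fixes d n nu istar :: nat
    and X :: "nat \<Rightarrow> nat \<Rightarrow> real"
    and y :: "real Matrix.vec"
    and tau2 t :: real
    and k kt :: "nat \<Rightarrow> real \<Rightarrow> real \<Rightarrow> real"
    and Lam :: "nat \<Rightarrow> real set \<Rightarrow> real mat"
    and lo up :: "nat \<Rightarrow> real set \<Rightarrow> ereal Matrix.vec"
    and A :: "nat set"
    and S St :: "nat \<Rightarrow> real set"
    and xi_hat xi_tilde xi_bar eta_bar :: "nat \<Rightarrow> nat \<Rightarrow> real"
  assumes data: "\<forall>a\<in>{1..n}. \<forall>i\<in>{1..d}. X a i \<in> {0..1}"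
    and obs: "y \<in> carrier_vec n"
    and noise: "tau2 > 0"
    and active: "A \<subseteq> {1..d}"
    and star: "istar \<in> A"
    and nu: "nu \<in> {1..card (S istar) - 1}"
    and t: "knot (S istar) nu < t" "t < knot (S istar) (nu + 1)"
    and St: "St = S(istar := insert t (S istar))"
    and model: "model_assumptions n X tau2 k Lam lo up A S"
    and refined_model: "model_assumptions n X tau2 kt Lam lo up A St"
    and xi_hat: "xi_hat = mode_coeffs X y tau2 k Lam lo up A S"
    and xi_tilde: "xi_tilde = mode_coeffs X y tau2 kt Lam lo up A St"
    and xi_bar: "xi_bar = (\<lambda>i j.
          if i \<noteq> istar then xi_hat i j
          else if j \<le> nu then xi_hat i j
          else if j = nu + 1 then
            xi_hat istar nu * ((knot (S istar) (nu + 1) - t)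
              / (knot (S istar) (nu + 1) - knot (S istar) nu))
            + xi_hat istar (nu + 1) * ((t - knot (S istar) nu)
              / (knot (S istar) (nu + 1) - knot (S istar) nu))
          else xi_hat i (j - 1))"
    and eta_bar: "eta_bar = (\<lambda>i j. xi_bar i j - xi_tilde i j)"
  shows
    "((LINT x:(\<Pi>\<^sub>E i\<in>A. {0..1})|(\<Pi>\<^sub>M i\<in>A. lborel).
         (mode_fun A S xi_hat x - mode_fun A St xi_tilde x)\<^sup>2)
     = (\<Sum>i\<in>A. \<Sum>(j, j') \<in> {(j, j'). j \<in> {1..card (St i)} \<and> j' \<in> {1..card (St i)}
                                   \<and> \<bar>int j - int j'\<bar> \<le> 1}.
          eta_bar i j * eta_bar i j' * hat_integral2 (St i) j j')
       - (\<Sum>i\<in>A. (\<Sum>j = 1..card (St i). eta_bar i j * hat_integral (St i) j)\<^sup>2)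
       + (\<Sum>i\<in>A. \<Sum>j = 1..card (St i). eta_bar i j * hat_integral (St i) j)\<^sup>2)
     \<and> (\<forall>i\<in>A. \<forall>j\<in>{1..card (St i)}.
           hat_integral (St i) j = hat_integral_explicit (St i) j \<and>
           (\<forall>j'\<in>{1..card (St i)}. hat_integral2 (St i) j j' = hat_integral2_explicit (St i) j j'))
     \<and> (expr_val (mode_distance_input A S istar nu t xi_hat xi_tilde) mode_distance_expr (\<lambda>_. 0)
     = (LINT x:(\<Pi>\<^sub>E i\<in>A. {0..1})|(\<Pi>\<^sub>M i\<in>A. lborel).
         (mode_fun A S xi_hat x - mode_fun A St xi_tilde x)\<^sup>2))
     \<and> (\<exists>c C :: real. 0 < c \<and> 0 < C \<and>
           (\<forall>B R p q s f g.
              finite B \<and> (\<forall>i\<in>B. subdivision (R i)) \<and> p \<in> B \<and> q \<in> {1..card (R p) - 1} \<and>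
              knot (R p) q < s \<and> s < knot (R p) (q + 1) \<longrightarrow>
              (let m = real (\<Sum>i\<in>B. card (R i));
                   cost = real (expr_cost (mode_distance_input B R p q s f g)
                                  mode_distance_expr (\<lambda>_. 0))
               in c * m \<le> cost \<and> cost \<le> C * m)))"
proof -
  have fin: "finite A" using active finite_subset by blast
  have S: "subdivision (S i)" if "i \<in> A" for i
    using model that by (simp add: model_assumptions_def)
  have St_sub: "subdivision (St i)" if "i \<in> A" for i
    using refined_model that by (simp add: model_assumptions_def)
  let ?g = "\<lambda>i s. \<Sum>j = 1..card (St i). eta_bar i j * hat_basis (St i) j s"
  have diff: "mode_fun A S xi_hat x - mode_fun A St xi_tilde x = (\<Sum>i\<in>A. ?g i (x i))"
    if "x \<in> (\<Pi>\<^sub>E i\<in>A. {0..1})" for x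
  proof -
    \<comment> \<open>In the common refined basis the two modes subtract coefficientwise.\<close>
    have "mode_fun A S xi_hat x = mode_fun A St xi_bar x"
      unfolding St xi_bar using that by (intro mode_fun_insert S star nu t) auto
    then show ?thesis
      by (simp add: mode_fun_def eta_bar left_diff_distrib sum_subtractf)
  qed
  have distance: "(LINT x:(\<Pi>\<^sub>E i\<in>A. {0..1})|(\<Pi>\<^sub>M i\<in>A. lborel).
         (mode_fun A S xi_hat x - mode_fun A St xi_tilde x)\<^sup>2)
     = (\<Sum>i\<in>A. \<Sum>(j, j') \<in> {(j, j'). j \<in> {1..card (St i)} \<and> j' \<in> {1..card (St i)}
                                   \<and> \<bar>int j - int j'\<bar> \<le> 1}.
          eta_bar i j * eta_bar i j' * hat_integral2 (St i) j j')
       - (\<Sum>i\<in>A. (\<Sum>j = 1..card (St i). eta_bar i j * hat_integral (St i) j)\<^sup>2)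
       + (\<Sum>i\<in>A. \<Sum>j = 1..card (St i). eta_bar i j * hat_integral (St i) j)\<^sup>2"
    (is "?I = ?Q")
  proof -
    have "?I = (LINT x:(\<Pi>\<^sub>E i\<in>A. {0..1})|(\<Pi>\<^sub>M i\<in>A. lborel). (\<Sum>i\<in>A. ?g i (x i))\<^sup>2)"
      unfolding set_lebesgue_integral_def
      \<comment> \<open>Outside the cube the indicator makes both integrands 0, so
        \<open>diff\<close> is needed only inside it.\<close>
      by (intro Bochner_Integration.integral_cong refl) (simp add: diff indicator_def)
    also have "\<dots> = (\<Sum>i\<in>A. LINT s:{0..1}|lborel. (?g i s)\<^sup>2)
        - (\<Sum>i\<in>A. (LINT s:{0..1}|lborel. ?g i s)\<^sup>2) + (\<Sum>i\<in>A. LINT s:{0..1}|lborel. ?g i s)\<^sup>2"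
      by (intro integral_square_additive fin set_integrable_sum_hat_basis
          set_integrable_sum_hat_basis_square St_sub)
    also have "\<dots> = ?Q"
      using St_sub by (simp add: integral_sum_hat_basis integral_sum_hat_basis_square del: One_nat_def cong: sum.cong)
    finally show ?thesis .
  qed
  have explicit: "hat_integral (St i) j = hat_integral_explicit (St i) j"
    "j' \<in> {1..card (St i)} \<Longrightarrow> hat_integral2 (St i) j j' = hat_integral2_explicit (St i) j j'"
    if "i \<in> A" "j \<in> {1..card (St i)}" for i j j'
    using that St_sub by (simp_all add: hat_integral_eq_explicit hat_integral2_eq_explicit)
  have "expr_val (mode_distance_input A S istar nu t xi_hat xi_tilde) mode_distance_expr (\<lambda>_. 0)
    = (\<Sum>i\<in>A. \<Sum>(j, j') \<in> {(j, j'). j \<in> {1..card (St i)} \<and> j' \<in> {1..card (St i)}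
                                   \<and> \<bar>int j - int j'\<bar> \<le> 1}.
          eta_bar i j * eta_bar i j' * hat_integral2_explicit (St i) j j')
       - (\<Sum>i\<in>A. (\<Sum>j = 1..card (St i). eta_bar i j * hat_integral_explicit (St i) j)\<^sup>2)
       + (\<Sum>i\<in>A. \<Sum>j = 1..card (St i). eta_bar i j * hat_integral_explicit (St i) j)\<^sup>2"
    unfolding St by (rule expr_val_mode_distance_expr) (simp add: eta_bar xi_bar)
  \<comment> \<open>The explicit expressions are known to agree with the integrals for indices in
    \<open>1..card (St i)\<close>, so they are replaced under the sums by congruence.\<close>
  also have "\<dots> = ?Q"
  proof -
    have "(\<Sum>j = 1..card (St i). eta_bar i j * hat_integral_explicit (St i) j)
        = (\<Sum>j = 1..card (St i). eta_bar i j * hat_integral (St i) j)" if "i \<in> A" for i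
      using that by (intro sum.cong refl) (simp add: explicit)
    moreover have "(\<Sum>(j, j') \<in> {(j, j'). j \<in> {1..card (St i)} \<and> j' \<in> {1..card (St i)}
          \<and> \<bar>int j - int j'\<bar> \<le> 1}. eta_bar i j * eta_bar i j' * hat_integral2_explicit (St i) j j')
        = (\<Sum>(j, j') \<in> {(j, j'). j \<in> {1..card (St i)} \<and> j' \<in> {1..card (St i)}
          \<and> \<bar>int j - int j'\<bar> \<le> 1}. eta_bar i j * eta_bar i j' * hat_integral2 (St i) j j')"
      if "i \<in> A" for i
      using that by (intro sum.cong refl) (auto simp: explicit)
    ultimately show ?thesis by (simp only: cong: sum.cong)
  qed
  finally have value_eq: "expr_val (mode_distance_input A S istar nu t xi_hat xi_tilde)
      mode_distance_expr (\<lambda>_. 0) = ?I"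
    unfolding distance .
  have "\<exists>c C :: real. 0 < c \<and> 0 < C \<and>
           (\<forall>B R p q s f g.
              finite B \<and> (\<forall>i\<in>B. subdivision (R i)) \<and> p \<in> B \<and> q \<in> {1..card (R p) - 1} \<and>
              knot (R p) q < s \<and> s < knot (R p) (q + 1) \<longrightarrow>
              (let m = real (\<Sum>i\<in>B. card (R i));
                   cost = real (expr_cost (mode_distance_input B R p q s f g)
                                  mode_distance_expr (\<lambda>_. 0))
               in c * m \<le> cost \<and> cost \<le> C * m))"
  \<comment> \<open>The witnesses are the constants of \<open>mode_distance_cost_linear\<close>,
    chosen before and hence uniform in all inputs.\<close>
  proof (rule exI[of _ 1], rule exI[of _ 3000], intro conjI allI impI, goal_cases)
    case (3 B R p q s f g)
    let ?m = "\<Sum>i\<in>B. card (R i)"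
    let ?cost = "expr_cost (mode_distance_input B R p q s f g) mode_distance_expr (\<lambda>_. 0)"
    have "?m \<le> ?cost" "?cost \<le> 3000 * ?m"
      using 3 by (intro mode_distance_cost_linear; simp)+
    then have "real ?m \<le> real ?cost" "real ?cost \<le> real (3000 * ?m)"
      by (simp_all only: of_nat_le_iff)
    then show ?case unfolding Let_def by (simp only: of_nat_mult of_nat_numeral mult_1_left simp_thms)
  qed simp_all
  then show ?thesis using distance explicit value_eq by (intro conjI ballI)
qed

end
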